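(* Fix $k\ge1$ and let $\mathcal{X}=\{0,1\}^{\mathbb{N}^k}$ with the product (uniform) measure $\lambda$. Let $\mathcal{P}\subseteq\mathcal{X}$ be a $\Pi^0_1$ class with $\lambda(\mathcal{P})>0$, and let $Z\in\mathcal{X}$. Then $Z$ is multiply recurrent in $\mathcal{P}$, i.e. there is $n\ge1$ with $Z\in\bigcap_{1\le i\le k}T_i^{-n}(\mathcal{P})$, in each of the following cases: (a) $Z$ is Kurtz random and $\mathcal{P}$ is clopen; (b) $Z$ is Schnorr random and $\lambda(\mathcal{P})$ is a computable real; (c) $Z$ is Martin-Löf random (and $\mathcal{P}$ is an arbitrary such $\Pi^0_1$ class).
   Context: For $1\le i\le k$ the shift $T_i\colon\mathcal{X}\to\mathcal{X}$ is defined by $T_i(Z)(u_1,\ldots,u_k)=Z(u_1,\ldots,u_i+1,\ldots,u_k)$. Effectivity notions ($\Pi^0_1$ classes, computability of measures) and randomness notions on $\mathcal{X}$ are transferred from Cantor space $\{0,1\}^{\mathbb{N}}$ via the measure-preserving isomorphism induced by a computable bijection $\mathbb{N}^k\to\mathbb{N}$. On Cantor space with uniform measure: a $\Sigma^0_1$ class is $\{Y:\exists\sigma\in S,\ \sigma\prec Y\}$ for a c.e. set $S$ of strings, a $\Pi^0_1$ class is the complement of one; $Z$ is Kurtz random if it lies in no $\Pi^0_1$ class of measure $0$; $Z$ is Martin-Löf random if $Z\notin\bigcap_m U_m$ for every uniformly c.e. sequence of $\Sigma^0_1$ classes with $\lambda(U_m)\le2^{-m}$; $Z$ is Schnorr random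 if the same holds for all such sequences where additionally $\lambda(U_m)$ is computable uniformly in $m$. *)

theory Defs
  imports "HOL-Probability.Probability" "HOL-Library.Nat_Bijection"
begin

text \<open>Total recursive functions of fixed arity, with minimization restricted to the regular case.
  Only the values on argument lists of length \<open>n\<close> matter (rule \<open>ext\<close>).\<close>

inductive computable :: "nat \<Rightarrow> (nat list \<Rightarrow> nat) \<Rightarrow> bool" where
  zero: "computable n (\<lambda>xs. 0)"
| succ: "computable 1 (\<lambda>xs. Suc (xs ! 0))"
| proj: "i < n \<Longrightarrow> computable n (\<lambda>xs. xs ! i)"
| comp: "computable (length gs) f \<Longrightarrow> \<forall>g \<in> set gs. computable n g \<Longrightarrow>
    computable n (\<lambda>xs. f (map (\<lambda>g. g xs) gs))"
| prim_rec: "computable n f \<Longrightarrow> computable (Suc (Suc n)) g \<Longrightarrow>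
    computable (Suc n) (\<lambda>xs. rec_nat (f (tl xs)) (\<lambda>y r. g (y # r # tl xs)) (hd xs))"
| minimize: "computable (Suc n) f \<Longrightarrow> \<forall>xs. length xs = n \<longrightarrow> (\<exists>y. f (y # xs) = 0) \<Longrightarrow>
    computable n (\<lambda>xs. LEAST y. f (y # xs) = 0)"
| ext: "computable n f \<Longrightarrow> \<forall>xs. length xs = n \<longrightarrow> f xs = g xs \<Longrightarrow> computable n g"

definition ce :: "nat set \<Rightarrow> bool" where
  "ce A \<longleftrightarrow> A = {} \<or> (\<exists>f. computable 1 f \<and> A = range (\<lambda>x. f [x]))"

text \<open>A binary string is identified with the positive number whose binary digits, least
  significant first, are those of the string followed by a final 1.\<close>

definition string_code :: "bool list \<Rightarrow> nat" where
  "string_code \<sigma> = horner_sum of_bool 2 (\<sigma> @ [True])"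

definition ce_strings :: "bool list set \<Rightarrow> bool" where
  "ce_strings S \<longleftrightarrow> ce (string_code ` S)"

definition uniformly_ce_strings :: "(nat \<Rightarrow> bool list set) \<Rightarrow> bool" where
  "uniformly_ce_strings S \<longleftrightarrow> ce {prod_encode (m, string_code \<sigma>) | m \<sigma>. \<sigma> \<in> S m}"

text \<open>Rational approximations are coded as \<open>(a - b) / (c + 1)\<close> with natural \<open>a\<close>, \<open>b\<close>, \<open>c\<close>.\<close>

definition computable_real :: "real \<Rightarrow> bool" where
  "computable_real x \<longleftrightarrow> (\<exists>a b c. computable 1 a \<and> computable 1 b \<and> computable 1 c \<and>
    (\<forall>n. \<bar>x - (real (a [n]) - real (b [n])) / real (Suc (c [n]))\<bar> \<le> (1/2) ^ n))"

definition uniformly_computable_reals :: "(nat \<Rightarrow> real) \<Rightarrow> bool" where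
  "uniformly_computable_reals x \<longleftrightarrow> (\<exists>a b c. computable 2 a \<and> computable 2 b \<and> computable 2 c \<and>
    (\<forall>m n. \<bar>x m - (real (a [m, n]) - real (b [m, n])) / real (Suc (c [m, n]))\<bar> \<le> (1/2) ^ n))"

definition cantor_measure :: "(nat \<Rightarrow> bool) measure" where
  "cantor_measure = PiM UNIV (\<lambda>_. measure_pmf (pmf_of_set UNIV))"

definition string_prefix :: "bool list \<Rightarrow> (nat \<Rightarrow> bool) \<Rightarrow> bool" where
  "string_prefix \<sigma> Y \<longleftrightarrow> (\<forall>i < length \<sigma>. \<sigma> ! i = Y i)"

definition open_class :: "bool list set \<Rightarrow> (nat \<Rightarrow> bool) set" where
  "open_class S = {Y. \<exists>\<sigma> \<in> S. string_prefix \<sigma> Y}"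

definition Sigma01_class :: "(nat \<Rightarrow> bool) set \<Rightarrow> bool" where
  "Sigma01_class U \<longleftrightarrow> (\<exists>S. ce_strings S \<and> U = open_class S)"

definition Pi01_class :: "(nat \<Rightarrow> bool) set \<Rightarrow> bool" where
  "Pi01_class P \<longleftrightarrow> Sigma01_class (- P)"

definition uniformly_Sigma01 :: "(nat \<Rightarrow> (nat \<Rightarrow> bool) set) \<Rightarrow> bool" where
  "uniformly_Sigma01 U \<longleftrightarrow> (\<exists>S. uniformly_ce_strings S \<and> (\<forall>m. U m = open_class (S m)))"

definition Kurtz_random :: "(nat \<Rightarrow> bool) \<Rightarrow> bool" where
  "Kurtz_random Y \<longleftrightarrow> (\<forall>P. Pi01_class P \<and> measure cantor_measure P = 0 \<longrightarrow> Y \<notin> P)"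

definition Martin_Loef_test :: "(nat \<Rightarrow> (nat \<Rightarrow> bool) set) \<Rightarrow> bool" where
  "Martin_Loef_test U \<longleftrightarrow> uniformly_Sigma01 U \<and> (\<forall>m. measure cantor_measure (U m) \<le> (1/2) ^ m)"

definition Schnorr_test :: "(nat \<Rightarrow> (nat \<Rightarrow> bool) set) \<Rightarrow> bool" where
  "Schnorr_test U \<longleftrightarrow> Martin_Loef_test U \<and> uniformly_computable_reals (\<lambda>m. measure cantor_measure (U m))"

definition Martin_Loef_random :: "(nat \<Rightarrow> bool) \<Rightarrow> bool" where
  "Martin_Loef_random Y \<longleftrightarrow> (\<forall>U. Martin_Loef_test U \<longrightarrow> Y \<notin> (\<Inter>m. U m))"

definition Schnorr_random :: "(nat \<Rightarrow> bool) \<Rightarrow> bool" where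
  "Schnorr_random Y \<longleftrightarrow> (\<forall>U. Schnorr_test U \<longrightarrow> Y \<notin> (\<Inter>m. U m))"

text \<open>Elements of \<open>\<nat>\<^sup>k\<close> are lists of length \<open>k\<close>, and elements of \<open>{0,1}\<close> to the power \<open>\<nat>\<^sup>k\<close>
  are extensional functions on \<open>index k\<close>. Coordinates are numbered from 0.\<close>

definition index :: "nat \<Rightarrow> nat list set" where
  "index k = {u. length u = k}"

definition array_space :: "nat \<Rightarrow> (nat list \<Rightarrow> bool) set" where
  "array_space k = (index k \<rightarrow>\<^sub>E UNIV)"

definition array_measure :: "nat \<Rightarrow> (nat list \<Rightarrow> bool) measure" where
  "array_measure k = PiM (index k) (\<lambda>_. measure_pmf (pmf_of_set UNIV))"

definition array_topology :: "nat \<Rightarrow> (nat list \<Rightarrow> bool) topology" where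
  "array_topology k = product_topology (\<lambda>_. discrete_topology UNIV) (index k)"

definition clopen_in_array :: "nat \<Rightarrow> (nat list \<Rightarrow> bool) set \<Rightarrow> bool" where
  "clopen_in_array k P \<longleftrightarrow> openin (array_topology k) P \<and> closedin (array_topology k) P"

definition shift :: "nat \<Rightarrow> nat \<Rightarrow> (nat list \<Rightarrow> bool) \<Rightarrow> (nat list \<Rightarrow> bool)" where
  "shift k i Z = (\<lambda>u \<in> index k. Z (u[i := u ! i + 1]))"

definition multiply_recurrent :: "nat \<Rightarrow> (nat list \<Rightarrow> bool) set \<Rightarrow> (nat list \<Rightarrow> bool) \<Rightarrow> bool" where
  "multiply_recurrent k P Z \<longleftrightarrow> (\<exists>n \<ge> 1. Z \<in> (\<Inter>i \<in> {..<k}. (shift k i ^^ n) -` P))"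

definition computable_bijection :: "nat \<Rightarrow> (nat list \<Rightarrow> nat) \<Rightarrow> bool" where
  "computable_bijection k \<pi> \<longleftrightarrow> computable k \<pi> \<and> bij_betw \<pi> (index k) UNIV"

text \<open>The isomorphism onto Cantor space induced by a bijection \<open>\<pi>\<close> from \<open>\<nat>\<^sup>k\<close> to \<open>\<nat>\<close>.\<close>

definition to_cantor :: "nat \<Rightarrow> (nat list \<Rightarrow> nat) \<Rightarrow> (nat list \<Rightarrow> bool) \<Rightarrow> (nat \<Rightarrow> bool)" where
  "to_cantor k \<pi> Z = (\<lambda>n. Z (inv_into (index k) \<pi> n))"

definition Pi01_array_class :: "nat \<Rightarrow> (nat list \<Rightarrow> nat) \<Rightarrow> (nat list \<Rightarrow> bool) set \<Rightarrow> bool" where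
  "Pi01_array_class k \<pi> P \<longleftrightarrow> P \<subseteq> array_space k \<and> Pi01_class (to_cantor k \<pi> ` P)"

end

theory Submission imports Defs begin

text \<open>Let \<open>U\<close> be the complement of \<open>P\<close>, an effectively open set of measure less than 1, and call \<open>Y\<close> bad
  for \<open>n\<close> if some \<open>n\<close>-fold shift of \<open>Y\<close> lies in \<open>U\<close>; if \<open>Z\<close> is not multiply recurrent, then it is bad for
  every \<open>n \<ge> 1\<close>. Clopen approximations of \<open>U\<close> have independent images under high powers of the \<open>k\<close> shifts, so
  badness for a large \<open>n\<close> has probability at most some \<open>c < 1\<close>. Once badness for some power has been seen on a
  finite prefix of \<open>Y\<close>, choose the next power so large that it reads only coordinates beyond this prefix; by
  independence, \<open>r\<close> such events occur with probability at most \<open>c\<^sup>r\<close>. This gives a Martin-Loef test. If the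
  measure of \<open>U\<close> is computable, then so are the measures of the test, which is then a Schnorr test. If \<open>P\<close> is
  clopen, then the set of all \<open>Y\<close> that are bad for every \<open>n\<close> is itself a null \<open>\<Pi>\<^sup>0\<^sub>1\<close> class.\<close>

text \<open>Badness for \<open>n\<close> may depend on infinitely many coordinates, and those read
  for two different powers may overlap, so powers fixed in advance need not give independent events.
  An open event is however certified by a finite prefix, and this is why each power is chosen only
  after the previous event has been seen. The bound is \<open>c = 1 - p ^ k / 2\<close> with
  \<open>p\<close> the measure of \<open>P\<close>: exact independence of the \<open>k\<close>
  shifts is available only for a clopen approximation of \<open>U\<close>, whose \<open>k\<close>
  images are avoided together with probability at least \<open>p ^ k\<close>; the approximation
  error is kept below half of that. In the Schnorr case the obstacle is that the wait for an event
  has no bound, so computing the measures of the test requires a rate at which the clopen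
  approximations exhaust \<open>U\<close>; a computable measure of \<open>U\<close> supplies it. In
  the clopen case the failure of badness is also visible on a finite prefix, which makes the set of
  always bad sequences effectively closed; its nullity comes from the same bound
  \<open>c ^ r\<close>.\<close>

section \<open>Recursive functions of an environment\<close>

text \<open>Arguments are read from an environment \<open>nat \<Rightarrow> nat\<close> rather than from a list of fixed length.
  This removes arities, and a binder merely pushes its variable in front of the environment.\<close>

definition has_arity :: "nat \<Rightarrow> ((nat \<Rightarrow> nat) \<Rightarrow> nat) \<Rightarrow> bool" where
  "has_arity n F \<longleftrightarrow> (\<forall>e e'. (\<forall>i<n. e i = e' i) \<longrightarrow> F e = F e') \<and> computable n (\<lambda>xs. F (nth xs))"

definition recursive :: "((nat \<Rightarrow> nat) \<Rightarrow> nat) \<Rightarrow> bool" where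
  "recursive F \<longleftrightarrow> (\<exists>n. has_arity n F)"

definition decidable :: "((nat \<Rightarrow> nat) \<Rightarrow> bool) \<Rightarrow> bool" where
  "decidable P \<longleftrightarrow> recursive (\<lambda>e. of_bool (P e))"

lemma recursiveI:
  assumes "\<And>e e'. (\<And>i. i < n \<Longrightarrow> e i = e' i) \<Longrightarrow> F e = F e'" "computable n (\<lambda>xs. F (nth xs))"
  shows "recursive F"
  unfolding recursive_def has_arity_def by (rule exI[of _ n]) (use assms in blast)

lemma computable_comp_upt:
  assumes "computable n f" "\<And>i. i < n \<Longrightarrow> computable m (g i)"
  shows "computable m (\<lambda>xs. f (map (\<lambda>i. g i xs) [0..<n]))"
proof -
  have "computable m (\<lambda>xs. f (map (\<lambda>g. g xs) (map g [0..<n])))"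
    by (rule computable.comp) (use assms in auto)
  then show ?thesis by (simp add: comp_def)
qed

lemma has_arity_cong: "has_arity n F \<Longrightarrow> (\<And>i. i < n \<Longrightarrow> e i = e' i) \<Longrightarrow> F e = F e'"
  by (simp add: has_arity_def)

lemma has_arity_computable: "has_arity n F \<Longrightarrow> computable n (\<lambda>xs. F (nth xs))"
  by (simp add: has_arity_def)

lemma has_arity_mono:
  assumes F: "has_arity n F" and "n \<le> m"
  shows "has_arity m F"
  unfolding has_arity_def
proof (intro conjI allI impI)
  show "F e = F e'" if "\<forall>i<m. e i = e' i" for e e'
    by (rule has_arity_cong[OF F]) (use that \<open>n \<le> m\<close> in auto)
  have "computable m (\<lambda>xs. F (nth (map (\<lambda>i. xs ! i) [0..<n])))"
    by (rule computable_comp_upt[OF has_arity_computable[OF F]])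
       (use \<open>n \<le> m\<close> in \<open>auto intro: computable.proj\<close>)
  then show "computable m (\<lambda>xs. F (nth xs))"
    by (rule computable.ext) (auto intro!: has_arity_cong[OF F])
qed

lemma recursive_arity: "recursive F \<Longrightarrow> \<exists>n. \<forall>m\<ge>n. has_arity m F"
  unfolding recursive_def by (blast intro: has_arity_mono)

text \<open>\<open>F\<close> reads only its first \<open>n\<close> entries, so only finitely many of
  the \<open>g i\<close> matter, and these have a common arity.\<close>

lemma recursive_subst:
  assumes F: "recursive F" and g: "\<And>i. recursive (g i)"
  shows "recursive (\<lambda>e. F (\<lambda>i. g i e))"
proof -
  obtain n where n: "has_arity n F" using recursive_arity[OF F] by blast
  obtain N where N: "\<And>i m. N i \<le> m \<Longrightarrow> has_arity m (g i)"
    using recursive_arity[OF g] by metis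
  define M where "M = (\<Sum>i<n. N i)"
  have M: "has_arity M (g i)" if "i < n" for i
    unfolding M_def using that by (intro N member_le_sum) auto
  show ?thesis
  proof (rule recursiveI[of M])
    show "F (\<lambda>i. g i e) = F (\<lambda>i. g i e')" if "\<And>i. i < M \<Longrightarrow> e i = e' i" for e e'
      by (rule has_arity_cong[OF n], rule has_arity_cong[OF M]) (use that in auto)
    have "computable M (\<lambda>xs. F (nth (map (\<lambda>i. g i (nth xs)) [0..<n])))"
      by (rule computable_comp_upt[OF has_arity_computable[OF n]]) (rule has_arity_computable[OF M])
    then show "computable M (\<lambda>xs. F (\<lambda>i. g i (nth xs)))"
      by (rule computable.ext) (auto intro!: has_arity_cong[OF n])
  qed
qed

lemma recursive_var: "recursive (\<lambda>e. e i)"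
  by (rule recursiveI[of "Suc i"]) (auto intro: computable.proj)

lemma recursive_zero: "recursive (\<lambda>e. 0)"
  by (rule recursiveI[of 0]) (auto intro: computable.zero)

lemma recursive_computable:
  assumes "computable n f" "\<And>i. i < n \<Longrightarrow> recursive (g i)"
  shows "recursive (\<lambda>e. f (map (\<lambda>i. g i e) [0..<n]))"
proof -
  have "recursive (\<lambda>e. f (map e [0..<n]))"
  proof (rule recursiveI[of n])
    show "computable n (\<lambda>xs. f (map (nth xs) [0..<n]))"
      by (rule computable.ext[OF assms(1)]) (metis map_nth)
  qed (auto intro!: arg_cong[of _ _ f])
  moreover have "recursive (\<lambda>e. if i < n then g i e else 0)" for i
    using assms(2)[of i] recursive_zero by (cases "i < n") auto
  ultimately have "recursive (\<lambda>e. f (map (\<lambda>i. if i < n then g i e else 0) [0..<n]))"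
    by (rule recursive_subst)
  moreover have "map (\<lambda>i. if i < n then g i e else 0) [0..<n] = map (\<lambda>i. g i e) [0..<n]" for e
    by simp
  ultimately show ?thesis by simp
qed

text \<open>The arity that witnesses recursiveness may exceed 1, so the argument list is padded with
  zeros. Its length is \<open>Suc n\<close> in order that entry 0 exists even for
  \<open>n = 0\<close>.\<close>

lemma computable_recursive1:
  assumes "recursive (\<lambda>e. f (e 0))"
  shows "computable 1 (\<lambda>xs. f (xs ! 0))"
proof -
  obtain n where n: "\<And>m. n \<le> m \<Longrightarrow> computable m (\<lambda>xs. f (nth xs 0))"
    using recursive_arity[OF assms] has_arity_computable by blast
  have "computable 1 (\<lambda>xs. f (map (\<lambda>i. if i = 0 then xs ! 0 else 0) [0..<Suc n] ! 0))"
  proof (rule computable_comp_upt)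
    show "computable 1 (\<lambda>xs. if i = 0 then xs ! 0 else 0)" for i
      by (cases "i = 0") (auto intro: computable.proj computable.zero)
  qed (auto intro: n)
  then show ?thesis by (simp del: upt_Suc)
qed

lemma computable_recursive2:
  assumes "recursive (\<lambda>e. f (e 0) (e 1))"
  shows "computable 2 (\<lambda>xs. f (xs ! 0) (xs ! 1))"
proof -
  obtain n where n: "\<And>m. n \<le> m \<Longrightarrow> computable m (\<lambda>xs. f (nth xs 0) (nth xs 1))"
    using recursive_arity[OF assms] has_arity_computable by blast
  have "computable 2 (\<lambda>xs. f (map (\<lambda>i. if i < 2 then xs ! i else 0) [0..<Suc (Suc n)] ! 0)
      (map (\<lambda>i. if i < 2 then xs ! i else 0) [0..<Suc (Suc n)] ! 1))"
  proof (rule computable_comp_upt[where f="\<lambda>xs. f (nth xs 0) (nth xs 1)"])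
    show "computable 2 (\<lambda>xs. if i < 2 then xs ! i else 0)" for i
      by (cases "i < 2") (auto intro: computable.proj computable.zero)
  qed (use n in auto)
  then show ?thesis by (simp del: upt_Suc)
qed

lemma recursive_cong: "recursive F \<Longrightarrow> (\<And>e. F e = G e) \<Longrightarrow> recursive G"
  by (subgoal_tac "F = G") auto

lemma recursive_unary: "recursive (\<lambda>e. f (e 0)) \<Longrightarrow> recursive a \<Longrightarrow> recursive (\<lambda>e. f (a e))"
  using recursive_subst[of "\<lambda>e. f (e 0)" "\<lambda>_. a"] by simp

lemma recursive_binary:
  "recursive (\<lambda>e. f (e 0) (e 1)) \<Longrightarrow> recursive a \<Longrightarrow> recursive b \<Longrightarrow> recursive (\<lambda>e. f (a e) (b e))"
  using recursive_subst[of "\<lambda>e. f (e 0) (e 1)" "\<lambda>i. if i = 0 then a else b"] by simp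

lemma recursive_ternary:
  assumes "recursive (\<lambda>e. f (e 0) (e 1) (e 2))" "recursive a" "recursive b" "recursive c"
  shows "recursive (\<lambda>e. f (a e) (b e) (c e))"
  using recursive_subst[OF assms(1), of "\<lambda>i. if i = 0 then a else if i = 1 then b else c"] assms(2-)
  by simp

lemma recursive_push:
  assumes "recursive (\<lambda>e. h (e 0) (\<lambda>i. e (Suc i)))" "recursive b"
  shows "recursive (\<lambda>e. h (b e) e)"
  using recursive_subst[OF assms(1), of "\<lambda>i. case i of 0 \<Rightarrow> b | Suc j \<Rightarrow> (\<lambda>e. e j)"] assms(2)
  by (auto simp: recursive_var split: nat.splits)

text \<open>\<open>prim_rec\<close> recurses on the head of a list with the tail as parameters. So
  the counter is placed at position 0 in front of the shifted environment, and
  \<open>recursive_push\<close> then substitutes \<open>b\<close> for it.\<close>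

lemma recursive_rec:
  assumes a: "recursive a" and g: "recursive (\<lambda>e. g (e 0) (e 1) (\<lambda>i. e (Suc (Suc i))))" and b: "recursive b"
  shows "recursive (\<lambda>e. rec_nat (a e) (\<lambda>y r. g y r e) (b e))"
proof -
  let ?g = "\<lambda>e. g (e 0) (e 1) (\<lambda>i. e (Suc (Suc i)))"
  obtain n1 n2 where n: "\<And>m. n1 \<le> m \<Longrightarrow> has_arity m a" "\<And>m. n2 \<le> m \<Longrightarrow> has_arity m ?g"
    using recursive_arity[OF a] recursive_arity[OF g] by blast
  define n where "n = max n1 n2"
  have n1: "has_arity n a" and n2: "has_arity (Suc (Suc n)) ?g"
    unfolding n_def by (rule n, simp)+
  have "recursive (\<lambda>e. rec_nat (a (\<lambda>i. e (Suc i))) (\<lambda>y r. g y r (\<lambda>i. e (Suc i))) (e 0))"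
  proof (rule recursiveI[of "Suc n"])
    fix e e' :: "nat \<Rightarrow> nat" assume e: "\<And>i. i < Suc n \<Longrightarrow> e i = e' i"
    have 1: "a (\<lambda>i. e (Suc i)) = a (\<lambda>i. e' (Suc i))"
      by (rule has_arity_cong[OF n1]) (use e in auto)
    have 2: "g y r (\<lambda>i. e (Suc i)) = g y r (\<lambda>i. e' (Suc i))" for y r
      using has_arity_cong[OF n2, of "\<lambda>i. case i of 0 \<Rightarrow> y | Suc 0 \<Rightarrow> r | Suc (Suc j) \<Rightarrow> e (Suc j)"
         "\<lambda>i. case i of 0 \<Rightarrow> y | Suc 0 \<Rightarrow> r | Suc (Suc j) \<Rightarrow> e' (Suc j)"] e
      by (auto split: nat.splits)
    show "rec_nat (a (\<lambda>i. e (Suc i))) (\<lambda>y r. g y r (\<lambda>i. e (Suc i))) (e 0)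
      = rec_nat (a (\<lambda>i. e' (Suc i))) (\<lambda>y r. g y r (\<lambda>i. e' (Suc i))) (e' 0)"
      using e[of 0] by (simp add: 1 2)
  next
    have "computable (Suc n) (\<lambda>xs. rec_nat (a (nth (tl xs)))
       (\<lambda>y r. g ((y # r # tl xs) ! 0) ((y # r # tl xs) ! 1) (\<lambda>i. (y # r # tl xs) ! (Suc (Suc i)))) (hd xs))"
      by (rule computable.prim_rec[OF has_arity_computable[OF n1] has_arity_computable[OF n2]])
    moreover have "(\<lambda>i. tl xs ! i) = (\<lambda>i. xs ! Suc i)" if "length xs = Suc n" for xs :: "nat list"
      using that by (cases xs) auto
    ultimately show "computable (Suc n) (\<lambda>xs. rec_nat (a (\<lambda>i. xs ! Suc i)) (\<lambda>y r. g y r (\<lambda>i. xs ! Suc i)) (xs ! 0))"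
      by (elim computable.ext) (auto simp: hd_conv_nth length_Suc_conv)
  qed
  from recursive_push[OF this b] show ?thesis .
qed

lemma recursive_Suc: "recursive a \<Longrightarrow> recursive (\<lambda>e. Suc (a e))"
proof (rule recursive_unary[where f=Suc])
  show "recursive (\<lambda>e. Suc (e 0))"
    by (rule recursiveI[of 1]) (auto intro: computable.succ[simplified])
qed

lemma recursive_const: "recursive (\<lambda>e. c)"
  by (induction c) (auto intro: recursive_zero recursive_Suc)

text \<open>\<open>minimize\<close> searches for a zero, whereas the characteristic function of
  \<open>P\<close> is 1 where \<open>P\<close> holds; it is therefore applied to the
  negation.\<close>

lemma recursive_Least:
  assumes P: "decidable (\<lambda>e. P (e 0) (\<lambda>i. e (Suc i)))" and ex: "\<And>e. \<exists>y. P y e"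
  shows "recursive (\<lambda>e. LEAST y. P y e)"
proof -
  \<comment> \<open>This recursion swaps 0 and 1; subtraction, from which negation is later derived
    in general, is not yet at hand.\<close>
  have "recursive (\<lambda>e. rec_nat 1 (\<lambda>y r. 0) (of_bool (P (e 0) (\<lambda>i. e (Suc i)))))"
    by (intro recursive_rec recursive_const P[unfolded decidable_def])
  then have "recursive (\<lambda>e. of_bool (\<not> P (e 0) (\<lambda>i. e (Suc i))))"
    by (rule recursive_cong) auto
  then obtain n where n: "has_arity (Suc n) (\<lambda>e. of_bool (\<not> P (e 0) (\<lambda>i. e (Suc i))))"
    using recursive_arity le_SucI by blast
  show ?thesis
  proof (rule recursiveI[of n])
    fix e e' :: "nat \<Rightarrow> nat" assume e: "\<And>i. i < n \<Longrightarrow> e i = e' i"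
    have "P y e = P y e'" for y
      using has_arity_cong[OF n, of "\<lambda>i. case i of 0 \<Rightarrow> y | Suc j \<Rightarrow> e j"
         "\<lambda>i. case i of 0 \<Rightarrow> y | Suc j \<Rightarrow> e' j"] e
      by (auto split: nat.splits)
    then show "(LEAST y. P y e) = (LEAST y. P y e')" by simp
  next
    have "computable n (\<lambda>xs. LEAST y. of_bool (\<not> P ((y # xs) ! 0) (\<lambda>i. (y # xs) ! Suc i)) = (0::nat))"
      by (rule computable.minimize[OF has_arity_computable[OF n]]) (use ex in auto)
    then show "computable n (\<lambda>xs. LEAST y. P y (nth xs))" by simp
  qed
qed

section \<open>Arithmetic, bounded quantifiers and pairing\<close>

lemma recursive_add: "recursive a \<Longrightarrow> recursive b \<Longrightarrow> recursive (\<lambda>e. a e + b e)"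
proof -
  assume "recursive a" "recursive b"
  then have "recursive (\<lambda>e. rec_nat (a e) (\<lambda>y r. Suc r) (b e))"
    by (intro recursive_rec recursive_Suc recursive_var)
  moreover have "rec_nat m (\<lambda>y r. Suc r) n = m + n" for m n by (induction n) auto
  ultimately show ?thesis by simp
qed

lemma recursive_mult: "recursive a \<Longrightarrow> recursive b \<Longrightarrow> recursive (\<lambda>e. a e * b e)"
proof (rule recursive_binary[where f="(*)"])
  have "recursive (\<lambda>e. rec_nat 0 (\<lambda>y r. r + e 0) (e 1))"
    by (intro recursive_rec recursive_add recursive_zero recursive_var)
  moreover have "rec_nat 0 (\<lambda>y r. r + m) n = m * n" for m n :: nat by (induction n) auto
  ultimately show "recursive (\<lambda>e. e 0 * e 1)" by simp
qed

lemma recursive_power: "recursive a \<Longrightarrow> recursive b \<Longrightarrow> recursive (\<lambda>e. a e ^ b e)"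
proof (rule recursive_binary[where f="(^)"])
  have "recursive (\<lambda>e. rec_nat 1 (\<lambda>y r. r * e 0) (e 1))"
    by (intro recursive_rec recursive_mult recursive_const recursive_var)
  moreover have "rec_nat 1 (\<lambda>y r. r * m) n = m ^ n" for m n :: nat by (induction n) auto
  ultimately show "recursive (\<lambda>e. e 0 ^ e 1)" by simp
qed

lemma recursive_pred: "recursive a \<Longrightarrow> recursive (\<lambda>e. a e - 1)"
proof -
  assume a: "recursive a"
  have "recursive (\<lambda>e. rec_nat 0 (\<lambda>y r. y) (a e))"
    by (rule recursive_rec[where g="\<lambda>y r e. y"]) (rule recursive_const recursive_var a)+
  then show ?thesis
    by (rule recursive_cong) (metis diff_0_eq_0 diff_Suc_1 nat.exhaust old.nat.simps(6,7))
qed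

lemma recursive_diff: "recursive a \<Longrightarrow> recursive b \<Longrightarrow> recursive (\<lambda>e. a e - b e)"
proof -
  assume a: "recursive a" "recursive b"
  have 1: "recursive (\<lambda>e. rec_nat (a e) (\<lambda>y r. r - 1) (b e))"
    by (rule recursive_rec[where g="\<lambda>y r e. r - 1"]) (rule recursive_pred recursive_var a)+
  have 2: "rec_nat m (\<lambda>y r. r - 1) n = m - n" for m n :: nat 
    by (induction n) simp_all
  show ?thesis by (rule recursive_cong[OF 1 2])
qed

lemma recursive_sum:
  assumes "recursive (\<lambda>e. f (e 0) (\<lambda>i. e (Suc i)))" "recursive b"
  shows "recursive (\<lambda>e. \<Sum>i<b e. f i e)"
proof -
  have 1: "recursive (\<lambda>e. f (e 0) (\<lambda>i. e (Suc (Suc i))))"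
    using recursive_subst[OF assms(1), of "\<lambda>i. case i of 0 \<Rightarrow> (\<lambda>e. e 0) | Suc j \<Rightarrow> (\<lambda>e. e (Suc (Suc j)))"]
    by (simp add: recursive_var split: nat.split)
  have 2: "recursive (\<lambda>e. rec_nat 0 (\<lambda>y r. r + f y e) (b e))"
    by (rule recursive_rec[where g="\<lambda>y r e. r + f y e"])
       (rule recursive_const recursive_add[OF recursive_var 1] assms(2))+
  have 3: "rec_nat 0 (\<lambda>y r. r + g y) n = (\<Sum>i<n. g i)" for g :: "nat \<Rightarrow> nat" and n
    by (induction n) auto
  show ?thesis by (rule recursive_cong[OF 2 3])
qed

lemma recursive_of_bool: "decidable P \<Longrightarrow> recursive (\<lambda>e. of_bool (P e))"
  by (simp add: decidable_def)

lemma decidable_not: "decidable P \<Longrightarrow> decidable (\<lambda>e. \<not> P e)"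
  unfolding decidable_def
  by (rule recursive_cong[OF recursive_diff[OF recursive_const[of 1], of "\<lambda>e. of_bool (P e)"]]) auto

lemma decidable_conj: "decidable P \<Longrightarrow> decidable Q \<Longrightarrow> decidable (\<lambda>e. P e \<and> Q e)"
  unfolding decidable_def of_bool_conj by (rule recursive_mult)

lemma decidable_cong: "decidable P \<Longrightarrow> (\<And>e. P e \<longleftrightarrow> Q e) \<Longrightarrow> decidable Q"
  by (subgoal_tac "P = Q") auto

lemma decidable_disj: "decidable P \<Longrightarrow> decidable Q \<Longrightarrow> decidable (\<lambda>e. P e \<or> Q e)"
  by (rule decidable_cong[OF decidable_not[OF decidable_conj[OF decidable_not[of P] decidable_not[of Q]]]]) auto

lemma decidable_le: "recursive a \<Longrightarrow> recursive b \<Longrightarrow> decidable (\<lambda>e. a e \<le> b e)"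
proof -
  assume "recursive a" "recursive b"
  then have "recursive (\<lambda>e. 1 - (a e - b e))" by (intro recursive_diff recursive_const)
  moreover have "1 - (m - n) = of_bool (m \<le> n)" for m n :: nat by auto
  ultimately show ?thesis unfolding decidable_def by (rule recursive_cong)
qed

lemma decidable_less: "recursive a \<Longrightarrow> recursive b \<Longrightarrow> decidable (\<lambda>e. a e < b e)"
  by (rule decidable_cong[OF decidable_le[OF recursive_Suc[of a], of b]]) auto

lemma decidable_eq: "recursive a \<Longrightarrow> recursive b \<Longrightarrow> decidable (\<lambda>e. a e = b e)"
  by (rule decidable_cong[OF decidable_conj[OF decidable_le decidable_le, of a b b a]]) auto

lemma decidable_binary:
  assumes "decidable (\<lambda>e. P (e 0) (e 1))" "recursive a" "recursive b"
  shows "decidable (\<lambda>e. P (a e) (b e))"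
  using recursive_binary[where f="\<lambda>x y. of_bool (P x y)"] assms unfolding decidable_def by blast

lemma decidable_ternary:
  assumes "decidable (\<lambda>e. P (e 0) (e 1) (e 2))" "recursive a" "recursive b" "recursive c"
  shows "decidable (\<lambda>e. P (a e) (b e) (c e))"
  using recursive_ternary[where f="\<lambda>x y z. of_bool (P x y z)"] assms unfolding decidable_def by blast

lemma decidable_const: "decidable (\<lambda>e. c)"
  unfolding decidable_def by (rule recursive_const)

lemma recursive_if:
  assumes "decidable P" "recursive a" "recursive b"
  shows "recursive (\<lambda>e. if P e then a e else b e)"
proof -
  have "recursive (\<lambda>e. of_bool (P e) * a e + of_bool (\<not> P e) * b e)"
    by (intro recursive_add recursive_mult recursive_of_bool decidable_not assms)
  then show ?thesis by (rule recursive_cong) auto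
qed

lemma decidable_ex_less:
  assumes "decidable (\<lambda>e. P (e 0) (\<lambda>i. e (Suc i)))" "recursive b"
  shows "decidable (\<lambda>e. \<exists>i<b e. P i e)"
proof -
  have "decidable (\<lambda>e. 0 < (\<Sum>i<b e. of_bool (P i e) :: nat))"
    by (intro decidable_less recursive_const recursive_sum recursive_of_bool assms)
  moreover have "0 < (\<Sum>i<n. of_bool (Q i) :: nat) \<longleftrightarrow> (\<exists>i<n. Q i)" for n :: nat and Q
    by (auto simp: zero_less_iff_neq_zero simp del: neq0_conv)
  ultimately show ?thesis by simp
qed

lemma decidable_all_less:
  assumes "decidable (\<lambda>e. P (e 0) (\<lambda>i. e (Suc i)))" "recursive b"
  shows "decidable (\<lambda>e. \<forall>i<b e. P i e)"
  by (rule decidable_cong[OF decidable_not[OF decidable_ex_less[of "\<lambda>i e. \<not> P i e" b]]])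
     (auto intro: decidable_not assms)

lemma decidable_ex_le:
  assumes "decidable (\<lambda>e. P (e 0) (\<lambda>i. e (Suc i)))" "recursive b"
  shows "decidable (\<lambda>e. \<exists>i\<le>b e. P i e)"
  using decidable_ex_less[OF assms(1) recursive_Suc[OF assms(2)]] by (simp add: less_Suc_eq_le)

text \<open>Each \<open>P i\<close> brings its own witness of decidability, with no uniformity in
  \<open>i\<close>: the maps \<open>\<phi> i\<close> are given as recursive separately for each
  \<open>i < k\<close>.\<close>

lemma decidable_ex_fixed:
  fixes k :: nat
  assumes "\<And>i. i < k \<Longrightarrow> decidable (P i)"
  shows "decidable (\<lambda>e. \<exists>i<k. P i e)"
  using assms
proof (induction k)
  case (Suc k)
  then have "decidable (\<lambda>e. P k e \<or> (\<exists>i<k. P i e))" by (intro decidable_disj) auto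
  then show ?case by (rule decidable_cong) (auto simp: less_Suc_eq)
qed (simp add: decidable_const)

lemma decidable_all_fixed:
  fixes k :: nat
  assumes "\<And>i. i < k \<Longrightarrow> decidable (P i)"
  shows "decidable (\<lambda>e. \<forall>i<k. P i e)"
  by (rule decidable_cong[OF decidable_not[OF decidable_ex_fixed[of k "\<lambda>i e. \<not> P i e"]]])
     (auto intro: decidable_not assms)

lemma recursive_sum_fixed:
  fixes k :: nat
  assumes "\<And>i. i < k \<Longrightarrow> recursive (f i)"
  shows "recursive (\<lambda>e. \<Sum>i<k. f i e)"
  using assms
proof (induction k)
  case (Suc k)
  then show ?case by (auto intro: recursive_add)
qed (simp add: recursive_const)

lemma recursive_div: "recursive a \<Longrightarrow> recursive b \<Longrightarrow> recursive (\<lambda>e. a e div b e)"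
proof (rule recursive_binary[where f="(div)"])
  \<comment> \<open>The disjunct \<open>e 1 = 0\<close> makes the search total; the value for
    divisor 0 is set by the conditional.\<close>
  have "recursive (\<lambda>e. if e 1 = 0 then 0 else LEAST q. e 0 < Suc q * e 1 \<or> e 1 = 0)"
    by (intro recursive_if decidable_eq recursive_const recursive_var recursive_Least
        decidable_disj decidable_less recursive_mult recursive_Suc)
       (metis dividend_less_times_div mult.commute mult_Suc not_gr_zero)
  moreover have "(LEAST q. m < Suc q * n \<or> n = 0) = m div n" if "n \<noteq> 0" for m n :: nat
  proof (rule Least_equality)
    show "m < Suc (m div n) * n \<or> n = 0"
      using that by (metis dividend_less_times_div mult.commute mult_Suc not_gr_zero)
    show "m div n \<le> y" if "m < Suc y * n \<or> n = 0" for y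
      using that \<open>n \<noteq> 0\<close> by (simp add: div_less_iff_less_mult[symmetric] less_Suc_eq_le del: mult_Suc)
  qed
  ultimately show "recursive (\<lambda>e. e 0 div e 1)" by (elim recursive_cong) auto
qed

lemma recursive_mod: "recursive a \<Longrightarrow> recursive b \<Longrightarrow> recursive (\<lambda>e. a e mod b e)"
  by (rule recursive_cong[OF recursive_diff[OF _ recursive_mult[OF recursive_div[of a b], of b], of a]])
     (auto simp: minus_div_mult_eq_mod)

lemma decidable_odd: "recursive a \<Longrightarrow> decidable (\<lambda>e. odd (a e))"
  by (rule decidable_cong[OF decidable_eq[OF recursive_mod[OF _ recursive_const[of 2]] recursive_const[of 1], of a]])
     (auto simp: odd_iff_mod_2_eq_one)

lemma recursive_prod_encode:
  "recursive a \<Longrightarrow> recursive b \<Longrightarrow> recursive (\<lambda>e. prod_encode (a e, b e))"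
  unfolding prod_encode_def triangle_def
  by (auto intro!: recursive_add recursive_div recursive_mult recursive_Suc recursive_const
      simp del: mult_Suc mult_Suc_right)

text \<open>Both components of a pair are bounded by its code, so one is found by minimization and
  the other by bounded search.\<close>

lemma recursive_fst_prod_decode: "recursive a \<Longrightarrow> recursive (\<lambda>e. fst (prod_decode (a e)))"
proof (rule recursive_unary[where f="\<lambda>x. fst (prod_decode x)"])
  have 1: "recursive (\<lambda>e. LEAST x. \<exists>y\<le>e 0. prod_encode (x, y) = e 0)"
    by (intro recursive_Least decidable_ex_le decidable_eq recursive_prod_encode recursive_var)
       (metis le_prod_encode_2 prod_decode_inverse prod.collapse)
  have 2: "(LEAST x. \<exists>y\<le>z. prod_encode (x, y) = z) = fst (prod_decode z)" for z
    by (rule Least_equality)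
       (metis le_prod_encode_2 prod_decode_inverse prod.collapse, metis fst_conv order_refl prod_encode_inverse)
  show "recursive (\<lambda>e. fst (prod_decode (e 0)))" by (rule recursive_cong[OF 1 2])
qed

lemma recursive_snd_prod_decode: "recursive a \<Longrightarrow> recursive (\<lambda>e. snd (prod_decode (a e)))"
proof (rule recursive_unary[where f="\<lambda>x. snd (prod_decode x)"])
  have 1: "recursive (\<lambda>e. LEAST y. \<exists>x\<le>e 0. prod_encode (x, y) = e 0)"
    by (intro recursive_Least decidable_ex_le decidable_eq recursive_prod_encode recursive_var)
       (metis le_prod_encode_1 prod_decode_inverse prod.collapse)
  have 2: "(LEAST y. \<exists>x\<le>z. prod_encode (x, y) = z) = snd (prod_decode z)" for z
    by (rule Least_equality)
       (metis le_prod_encode_1 prod_decode_inverse prod.collapse, metis snd_conv order_refl prod_encode_inverse)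
  show "recursive (\<lambda>e. snd (prod_decode (e 0)))" by (rule recursive_cong[OF 1 2])
qed

lemmas recursive_intros = recursive_Suc recursive_var recursive_const recursive_add recursive_mult
  recursive_power recursive_diff recursive_div recursive_mod recursive_if recursive_of_bool
  recursive_sum_fixed recursive_sum
  recursive_prod_encode decidable_not decidable_conj decidable_disj decidable_le
  decidable_less decidable_eq decidable_odd decidable_ex_fixed decidable_all_fixed
  decidable_ex_less decidable_all_less decidable_ex_le

lemma ce_decidable:
  assumes "decidable (\<lambda>e. D (e 0))"
  shows "ce {x. D x}"
proof (cases "{x. D x} = {}")
  case False
  then obtain a where a: "D a" by auto
  have "recursive (\<lambda>e. if D (e 0) then e 0 else a)"
    by (intro recursive_if assms recursive_var recursive_const)
  from computable_recursive1[OF this]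
  have "computable 1 (\<lambda>xs. if D (xs ! 0) then xs ! 0 else a)" .
  moreover have "{x. D x} = range (\<lambda>x. if D ([x] ! 0) then [x] ! 0 else a)"
    using a by auto
  ultimately show ?thesis unfolding ce_def by blast
qed (auto simp: ce_def)

section \<open>Prefixes and effectively open classes\<close>

text \<open>The number forgets trailing zeros, so predicates on prefixes receive the length
  \<open>t\<close> beside it. Effective classes are thus described by predicates of two numbers
  instead of sets of strings.\<close>

definition prefix_code :: "(nat \<Rightarrow> bool) \<Rightarrow> nat \<Rightarrow> nat" where
  "prefix_code Y t = horner_sum of_bool 2 (map Y [0..<t])"

lemma prefix_code_sum: "prefix_code Y t = (\<Sum>j<t. of_bool (Y j) * 2 ^ j)"
  by (simp add: prefix_code_def horner_sum_eq_sum atLeast0LessThan)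

lemma prefix_code_less: "prefix_code Y t < 2 ^ t"
  unfolding prefix_code_sum by (induction t) (auto simp: of_bool_def)

lemma prefix_code_mod: "s \<le> t \<Longrightarrow> prefix_code Y t mod 2 ^ s = prefix_code Y s"
  by (simp add: prefix_code_def take_map min_def take_bit_horner_sum_bit_eq flip: take_bit_eq_mod)

lemma odd_prefix_code_div: "j < t \<Longrightarrow> odd (prefix_code Y t div 2 ^ j) \<longleftrightarrow> Y j"
  by (simp add: prefix_code_def bit_horner_sum_bit_iff flip: bit_iff_odd)

lemma prefix_code_cong: "(\<And>j. j < t \<Longrightarrow> Y j = Y' j) \<Longrightarrow> prefix_code Y t = prefix_code Y' t"
  by (simp add: prefix_code_sum)

lemma prefix_code_eq_iff: "prefix_code Y t = prefix_code Y' t \<longleftrightarrow> (\<forall>j<t. Y j = Y' j)"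
  by (metis odd_prefix_code_div prefix_code_cong)

lemma prefix_code_bit: "x < 2 ^ t \<Longrightarrow> prefix_code (bit x) t = x"
  by (simp add: prefix_code_def horner_sum_bit_eq_take_bit take_bit_nat_eq_self)

lemma string_code_eq: "string_code \<sigma> = horner_sum of_bool 2 \<sigma> + 2 ^ length \<sigma>"
  unfolding string_code_def by (induction \<sigma>) auto

lemma string_prefix_iff: "string_prefix \<sigma> Y \<longleftrightarrow> \<sigma> = map Y [0..<length \<sigma>]"
proof
  show "\<sigma> = map Y [0..<length \<sigma>]" if "string_prefix \<sigma> Y"
    using that by (intro nth_equalityI) (simp_all add: string_prefix_def)
  show "string_prefix \<sigma> Y" if "\<sigma> = map Y [0..<length \<sigma>]"
    unfolding string_prefix_def by (subst that) simp
qed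

lemma open_class_Collect:
  "open_class {\<sigma>. D (length \<sigma>) (horner_sum of_bool 2 \<sigma>)} = {Y. \<exists>t. D t (prefix_code Y t)}"
proof -
  have "(\<exists>\<sigma>. D (length \<sigma>) (horner_sum of_bool 2 \<sigma>) \<and> string_prefix \<sigma> Y) \<longleftrightarrow> (\<exists>t. D t (prefix_code Y t))" for Y
  proof
    assume "\<exists>\<sigma>. D (length \<sigma>) (horner_sum of_bool 2 \<sigma>) \<and> string_prefix \<sigma> Y"
    then show "\<exists>t. D t (prefix_code Y t)" unfolding string_prefix_iff prefix_code_def by metis
  next
    assume "\<exists>t. D t (prefix_code Y t)"
    then obtain t where "D t (prefix_code Y t)" by blast
    then show "\<exists>\<sigma>. D (length \<sigma>) (horner_sum of_bool 2 \<sigma>) \<and> string_prefix \<sigma> Y"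
      by (intro exI[of _ "map Y [0..<t]"]) (simp add: string_prefix_iff prefix_code_def)
  qed
  then show ?thesis by (simp add: open_class_def)
qed

text \<open>The final digit 1 puts the codes of strings of length \<open>t\<close> exactly into the
  interval from \<open>2 ^ t\<close> to below \<open>2 ^ Suc t\<close>, so the code determines the
  length; \<open>t \<le> c\<close> keeps the search bounded.\<close>

lemma string_code_image_Collect:
  "string_code ` {\<sigma>. D (length \<sigma>) (horner_sum of_bool 2 \<sigma>)} =
    {c. \<exists>t\<le>c. 2 ^ t \<le> c \<and> c < 2 ^ Suc t \<and> D t (c - 2 ^ t)}" (is "?L = ?R")
proof (intro equalityI subsetI)
  fix c assume "c \<in> ?L"
  then obtain \<sigma> where \<sigma>: "D (length \<sigma>) (horner_sum of_bool 2 \<sigma>)" "c = horner_sum of_bool 2 \<sigma> + 2 ^ length \<sigma>"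
    by (auto simp: string_code_eq)
  moreover have "horner_sum of_bool 2 \<sigma> < (2::nat) ^ length \<sigma>"
    using prefix_code_less[of "nth \<sigma>" "length \<sigma>"] by (simp add: prefix_code_def map_nth)
  moreover have "length \<sigma> < 2 ^ length \<sigma>" by (rule less_exp)
  ultimately have "length \<sigma> \<le> c" "2 ^ length \<sigma> \<le> c" "c < 2 ^ Suc (length \<sigma>)"
    by (simp_all only: power_Suc)
  with \<sigma> show "c \<in> ?R" by (auto intro!: exI[of _ "length \<sigma>"])
next
  fix c assume "c \<in> ?R"
  then obtain t where t: "2 ^ t \<le> c" "c < 2 ^ Suc t" "D t (c - 2 ^ t)" by auto
  then have "horner_sum of_bool 2 (map (bit (c - 2 ^ t)) [0..<t]) = c - 2 ^ t"
    using prefix_code_bit[of "c - 2 ^ t" t] by (simp add: prefix_code_def)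
  with t show "c \<in> ?L"
    by (intro image_eqI[of _ _ "map (bit (c - 2 ^ t)) [0..<t]"]) (auto simp: string_code_eq)
qed

lemma Sigma01_class_decidable:
  assumes "decidable (\<lambda>e. D (e 0) (e 1))"
  shows "Sigma01_class {Y. \<exists>t. D t (prefix_code Y t)}"
proof -
  have "decidable (\<lambda>e. \<exists>t\<le>e 0. 2 ^ t \<le> e 0 \<and> e 0 < 2 ^ Suc t \<and> D t (e 0 - 2 ^ t))"
    by (intro recursive_intros decidable_binary[where P=D, OF assms])
  from ce_decidable[OF this] show ?thesis
    unfolding Sigma01_class_def ce_strings_def string_code_image_Collect[symmetric]
    using open_class_Collect by metis
qed

lemma uniformly_Sigma01_decidable:
  assumes "decidable (\<lambda>e. D (e 0) (e 1) (e 2))"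
  shows "uniformly_Sigma01 (\<lambda>m. {Y. \<exists>t. D m t (prefix_code Y t)})"
proof -
  define S where "S m = {\<sigma>. D m (length \<sigma>) (horner_sum of_bool 2 \<sigma>)}" for m
  have *: "{prod_encode (m, string_code \<sigma>) | m \<sigma>. \<sigma> \<in> S m} = {z. \<exists>m\<le>z. \<exists>c\<le>z. z = prod_encode (m, c) \<and>
      (\<exists>t\<le>c. 2 ^ t \<le> c \<and> c < 2 ^ Suc t \<and> D m t (c - 2 ^ t))}" (is "?L = ?R")
  proof -
    have "?L = {z. \<exists>m c. z = prod_encode (m, c) \<and> c \<in> string_code ` S m}" by auto
    also have "\<dots> = {z. \<exists>m c. z = prod_encode (m, c) \<and> (\<exists>t\<le>c. 2 ^ t \<le> c \<and> c < 2 ^ Suc t \<and> D m t (c - 2 ^ t))}"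
      unfolding S_def string_code_image_Collect by simp
    also have "\<dots> = ?R" using le_prod_encode_1 le_prod_encode_2 by blast
    finally show ?thesis .
  qed
  have "decidable (\<lambda>e. \<exists>m\<le>e 0. \<exists>c\<le>e 0. e 0 = prod_encode (m, c) \<and>
      (\<exists>t\<le>c. 2 ^ t \<le> c \<and> c < 2 ^ Suc t \<and> D m t (c - 2 ^ t)))"
    by (intro recursive_intros decidable_ternary[where P=D, OF assms])
  from ce_decidable[OF this] have "uniformly_ce_strings S"
    unfolding uniformly_ce_strings_def * .
  moreover have "open_class (S m) = {Y. \<exists>t. D m t (prefix_code Y t)}" for m
    unfolding S_def by (rule open_class_Collect)
  ultimately show ?thesis unfolding uniformly_Sigma01_def by (intro exI[of _ S]) blast
qed

text \<open>The enumeration is traded for a waiting time: \<open>W t x\<close> asks whether one of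
  the strings listed up to step \<open>t\<close>, and of length at most \<open>t\<close>, is an
  initial part of \<open>x\<close>. This is decidable, and waiting longer loses nothing.\<close>

lemma Sigma01_class_decidableE:
  assumes "Sigma01_class U"
  obtains W where "decidable (\<lambda>e. W (e 0) (e 1))"
    "\<And>Y s t. s \<le> t \<Longrightarrow> W s (prefix_code Y s) \<Longrightarrow> W t (prefix_code Y t)"
    "U = {Y. \<exists>t. W t (prefix_code Y t)}"
proof -
  obtain S where S: "ce (string_code ` S)" "U = open_class S"
    using assms by (auto simp: Sigma01_class_def ce_strings_def)
  show thesis
  proof (cases "S = {}")
    case True
    show ?thesis
      by (rule that[of "\<lambda>_ _. False"]) (auto simp: S True open_class_def decidable_const)
  next
    case False
    then obtain f where f: "computable 1 f" "string_code ` S = range (\<lambda>x. f [x])"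
      using S by (auto simp: ce_def)
    define W where "W t x \<longleftrightarrow> (\<exists>s\<le>t. \<exists>l\<le>t. f [s] = x mod 2 ^ l + 2 ^ l)" for t x
    have "recursive (\<lambda>e. f (map (\<lambda>i. e 0) [0..<1]))"
      by (rule recursive_computable[OF f(1)]) (rule recursive_var)
    then have f': "recursive (\<lambda>e. f [e 0])" by simp
    show ?thesis
    proof (rule that[of W])
      show "decidable (\<lambda>e. W (e 0) (e 1))" unfolding W_def
        by (intro recursive_intros recursive_unary[where f="\<lambda>x. f [x]", OF f'])
      show "W t (prefix_code Y t)" if st: "s \<le> t" and W: "W s (prefix_code Y s)" for Y s t
      proof -
        obtain s' l where "s' \<le> s" "l \<le> s" "f [s'] = prefix_code Y s mod 2 ^ l + 2 ^ l"
          using W unfolding W_def by blast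
        then have "s' \<le> t" "l \<le> t" "f [s'] = prefix_code Y t mod 2 ^ l + 2 ^ l"
          using st by (simp_all add: prefix_code_mod)
        then show ?thesis unfolding W_def by blast
      qed
      have "Y \<in> open_class S \<longleftrightarrow> (\<exists>t. W t (prefix_code Y t))" for Y
      proof
        assume "Y \<in> open_class S"
        then obtain \<sigma> where \<sigma>: "\<sigma> \<in> S" "string_prefix \<sigma> Y" by (auto simp: open_class_def)
        then have "string_code \<sigma> \<in> range (\<lambda>x. f [x])" unfolding f(2)[symmetric] by (intro imageI)
        then obtain s where s: "f [s] = string_code \<sigma>" by fastforce
        have "string_code \<sigma> = prefix_code Y (length \<sigma>) + 2 ^ length \<sigma>"
          using \<sigma>(2) unfolding string_code_eq prefix_code_def string_prefix_iff by simp
        then have "W (s + length \<sigma>) (prefix_code Y (s + length \<sigma>))"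
          unfolding W_def using s
          by (intro exI[of _ s] conjI exI[of _ "length \<sigma>"]) (simp_all add: prefix_code_mod)
        then show "\<exists>t. W t (prefix_code Y t)" ..
      next
        assume "\<exists>t. W t (prefix_code Y t)"
        then obtain t s l where "l \<le> t" "f [s] = prefix_code Y t mod 2 ^ l + 2 ^ l"
          unfolding W_def by blast
        then have fs: "f [s] = prefix_code Y l + 2 ^ l" by (simp add: prefix_code_mod)
        have "f [s] \<in> string_code ` S" unfolding f(2) by (rule rangeI)
        then obtain \<sigma> where \<sigma>: "\<sigma> \<in> S" "f [s] = string_code \<sigma>" by auto
        have "string_code \<sigma> = prefix_code (nth \<sigma>) (length \<sigma>) + 2 ^ length \<sigma>"
          by (simp add: string_code_eq prefix_code_def map_nth)
        with \<sigma> fs have eq: "prefix_code (nth \<sigma>) (length \<sigma>) + 2 ^ length \<sigma> = prefix_code Y l + 2 ^ l" by simp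
        \<comment> \<open>Codes of strings of different lengths lie in disjoint dyadic
          intervals.\<close>
        have "length \<sigma> = l"
        proof (rule ccontr)
          assume "length \<sigma> \<noteq> l"
          then consider "Suc (length \<sigma>) \<le> l" | "Suc l \<le> length \<sigma>" by linarith
          then show False
          proof cases
            case 1
            have "(2::nat) ^ Suc (length \<sigma>) \<le> 2 ^ l" by (rule power_increasing[OF 1]) simp
            with eq prefix_code_less[of "nth \<sigma>" "length \<sigma>"] show False by simp
          next
            case 2
            have "(2::nat) ^ Suc l \<le> 2 ^ length \<sigma>" by (rule power_increasing[OF 2]) simp
            with eq prefix_code_less[of Y l] show False by simp
          qed
        qed
        with eq have "string_prefix \<sigma> Y"
          by (simp add: prefix_code_eq_iff string_prefix_def)
        with \<sigma> show "Y \<in> open_class S" by (auto simp: open_class_def)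
      qed
      then show "U = {Y. \<exists>t. W t (prefix_code Y t)}" using S(2) by auto
    qed
  qed
qed

section \<open>The coin-tossing measure\<close>

interpretation coins: product_prob_space "\<lambda>_::nat. measure_pmf (pmf_of_set (UNIV :: bool set))" UNIV
  by standard

interpretation cantor: prob_space cantor_measure
  unfolding cantor_measure_def by (rule prob_space_PiM) (rule measure_pmf.prob_space_axioms)

lemma space_cantor [simp]: "space cantor_measure = UNIV"
  by (simp add: cantor_measure_def space_PiM)

lemma measurable_cantor_component [measurable]:
  "(\<lambda>Y. Y j) \<in> measurable cantor_measure (count_space UNIV)"
proof -
  have "(\<lambda>Y. Y j) \<in> measurable cantor_measure (measure_pmf (pmf_of_set (UNIV :: bool set)))"
    unfolding cantor_measure_def by (rule measurable_component_singleton) simp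
  then show ?thesis by (simp cong: measurable_cong_sets)
qed

lemma sets_cylinder [measurable]: "{Y. \<forall>j<t. Y j = y j} \<in> sets cantor_measure"
proof -
  have "{Y \<in> space cantor_measure. \<forall>j\<in>{..<t}. Y j = y j} \<in> sets cantor_measure"
    by measurable
  then show ?thesis by (simp add: lessThan_iff Ball_def)
qed

lemma prefix_class_eq_Union:
  "{Y. D (prefix_code Y t)} = (\<Union>x\<in>{x. x < 2 ^ t \<and> D x}. {Y. \<forall>j<t. Y j = bit x j})"
proof -
  have "prefix_code Y t = x \<longleftrightarrow> (\<forall>j<t. Y j = bit x j)" if "x < 2 ^ t" for Y x
    using prefix_code_eq_iff[of Y t "bit x"] prefix_code_bit[OF that] by simp
  note eq = this
  show ?thesis
  proof (intro equalityI subsetI)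
    fix Y assume "Y \<in> {Y. D (prefix_code Y t)}"
    then show "Y \<in> (\<Union>x\<in>{x. x < 2 ^ t \<and> D x}. {Y. \<forall>j<t. Y j = bit x j})"
      using eq[of "prefix_code Y t" Y] prefix_code_less[of Y t] by blast
  next
    fix Y assume "Y \<in> (\<Union>x\<in>{x. x < 2 ^ t \<and> D x}. {Y. \<forall>j<t. Y j = bit x j})"
    then obtain x where "x < 2 ^ t" "D x" "\<forall>j<t. Y j = bit x j" by blast
    then show "Y \<in> {Y. D (prefix_code Y t)}" using eq[of x Y] by simp
  qed
qed

lemma sets_prefix_class [measurable]: "{Y. D (prefix_code Y t)} \<in> sets cantor_measure"
  unfolding prefix_class_eq_Union by (intro sets.finite_UN) auto

lemma sets_ex_prefix_class [measurable]: "{Y. \<exists>t. D t (prefix_code Y t)} \<in> sets cantor_measure"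
proof -
  have "{Y. \<exists>t. D t (prefix_code Y t)} = (\<Union>t. {Y. D t (prefix_code Y t)})" by auto
  then show ?thesis by simp
qed

lemma prob_cylinder: "cantor.prob {Y. \<forall>j<t. Y j = y j} = (1/2) ^ t"
proof -
  have "emeasure cantor_measure {Y. \<forall>j<t. Y j = y j} = ennreal ((1/2) ^ t)"
    using coins.emeasure_PiM_Collect[of "{..<t}" "\<lambda>j. {y j}"]
    by (simp add: cantor_measure_def space_PiM emeasure_pmf_single Ball_def flip: ennreal_power)
  then show ?thesis by (simp add: cantor.emeasure_eq_measure)
qed

lemma prob_prefix_class:
  "cantor.prob {Y. D (prefix_code Y t)} = real (card {x. x < 2 ^ t \<and> D x}) / 2 ^ t"
proof -
  have "disjoint_family_on (\<lambda>x. {Y. \<forall>j<t. Y j = bit x j}) {x. x < 2 ^ t \<and> D x}"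
    unfolding disjoint_family_on_def
  proof (intro ballI impI)
    fix x x' :: nat assume x: "x \<in> {x. x < 2 ^ t \<and> D x}" "x' \<in> {x. x < 2 ^ t \<and> D x}" "x \<noteq> x'"
    have "\<not> (\<forall>j<t. bit x j = bit x' j)"
      using x prefix_code_eq_iff[of "bit x" t "bit x'"] prefix_code_bit by auto
    then show "{Y. \<forall>j<t. Y j = bit x j} \<inter> {Y. \<forall>j<t. Y j = bit x' j} = {}" by auto
  qed
  then have "cantor.prob {Y. D (prefix_code Y t)} = (\<Sum>x\<in>{x. x < 2 ^ t \<and> D x}. cantor.prob {Y. \<forall>j<t. Y j = bit x j})"
    unfolding prefix_class_eq_Union
    by (intro cantor.finite_measure_finite_Union) auto
  then show ?thesis by (simp add: prob_cylinder power_one_over field_simps)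
qed

lemma prob_prefix_class_sum:
  "cantor.prob {Y. D (prefix_code Y t)} = real (\<Sum>x<2 ^ t. of_bool (D x)) / 2 ^ t"
proof -
  have "(\<Sum>x<2 ^ t. of_bool (D x)) = card {x. x < 2 ^ t \<and> D x}"
    by (simp add: sum_of_bool_eq Int_def)
  then show ?thesis using prob_prefix_class[of D t] by simp
qed

lemma measurable_reindex: "(\<lambda>Y j. Y (\<phi> j)) \<in> measurable cantor_measure cantor_measure"
proof -
  have "(\<lambda>Y. \<lambda>j\<in>UNIV. Y (\<phi> j)) \<in> measurable cantor_measure cantor_measure"
    by (subst (2) cantor_measure_def, rule measurable_restrict)
       (use measurable_cantor_component in \<open>simp cong: measurable_cong_sets\<close>)
  then show ?thesis by (simp add: restrict_def)
qed

lemma sets_reindex: "E \<in> sets cantor_measure \<Longrightarrow> {Y. (\<lambda>j. Y (\<phi> j)) \<in> E} \<in> sets cantor_measure"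
  using measurable_sets[OF measurable_reindex, of E \<phi>] by (simp add: vimage_def)

text \<open>Selecting and renaming coordinates injectively preserves a product of equal factors. For
  the coordinate change of a shift power, this is invariance of the measure under the shift.\<close>

lemma prob_reindex:
  assumes "inj \<phi>" "E \<in> sets cantor_measure"
  shows "cantor.prob {Y. (\<lambda>j. Y (\<phi> j)) \<in> E} = cantor.prob E"
proof -
  have "distr cantor_measure cantor_measure (\<lambda>Y. \<lambda>j\<in>UNIV. Y (\<phi> j)) = cantor_measure"
    unfolding cantor_measure_def
    by (rule distr_PiM_reindex) (use assms in \<open>auto intro: measure_pmf.prob_space_axioms\<close>)
  then have "cantor.prob E = measure (distr cantor_measure cantor_measure (\<lambda>Y j. Y (\<phi> j))) E"
    by (simp add: restrict_def)
  also have "\<dots> = cantor.prob {Y. (\<lambda>j. Y (\<phi> j)) \<in> E}"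
    by (subst measure_distr[OF measurable_reindex assms(2)]) (simp add: vimage_def)
  finally show ?thesis ..
qed

lemma cantor_indep_components:
  "cantor.indep_vars (\<lambda>_. measure_pmf (pmf_of_set UNIV)) (\<lambda>i Y. Y i) UNIV"
proof (subst cantor.indep_vars_iff_distr_eq_PiM')
  show "(\<lambda>Y. Y i) \<in> cantor_measure \<rightarrow>\<^sub>M measure_pmf (pmf_of_set UNIV)" for i
    using measurable_cantor_component by (simp cong: measurable_cong_sets)
  have "distr cantor_measure (measure_pmf (pmf_of_set UNIV)) (\<lambda>Y. Y i) = measure_pmf (pmf_of_set UNIV)" for i
    unfolding cantor_measure_def by (rule distr_PiM_component) (auto intro: measure_pmf.prob_space_axioms)
  moreover have "distr cantor_measure cantor_measure (\<lambda>x. x) = cantor_measure" by (rule distr_id)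
  ultimately show "distr cantor_measure (PiM UNIV (\<lambda>_. measure_pmf (pmf_of_set UNIV))) (\<lambda>x. \<lambda>i\<in>UNIV. x i)
     = PiM UNIV (\<lambda>i. distr cantor_measure (measure_pmf (pmf_of_set UNIV)) (\<lambda>Y. Y i))"
    by (simp add: restrict_def flip: cantor_measure_def)
qed simp

text \<open>Each \<open>E l\<close> is rewritten as an event about the restriction of
  \<open>Y\<close> to \<open>J l\<close>, and restrictions of independent coordinates to disjoint
  sets are independent.\<close>

lemma prob_Inter_disjoint_support:
  assumes L: "finite L" "L \<noteq> {}" and J: "disjoint_family_on J L"
    and E: "\<And>l. l \<in> L \<Longrightarrow> E l \<in> sets cantor_measure"
    and dep: "\<And>l Y Y'. l \<in> L \<Longrightarrow> (\<And>j. j \<in> J l \<Longrightarrow> Y j = Y' j) \<Longrightarrow> Y \<in> E l \<Longrightarrow> Y' \<in> E l"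
  shows "cantor.prob (\<Inter>l\<in>L. E l) = (\<Prod>l\<in>L. cantor.prob (E l))"
proof -
  let ?M = "\<lambda>_::nat. measure_pmf (pmf_of_set (UNIV :: bool set))"
  \<comment> \<open>Coordinates outside \<open>J l\<close> are filled with \<open>False\<close>; by
    \<open>dep\<close> the filler does not affect membership in \<open>E l\<close>.\<close>
  define ext where "ext l = (\<lambda>z j. if j \<in> J l then z j else False)" for l
  define B where "B l = ext l -` E l \<inter> space (PiM (J l) ?M)" for l
  have "ext l \<in> measurable (PiM (J l) ?M) cantor_measure" for l
  proof -
    have "(\<lambda>z. \<lambda>j\<in>UNIV. if j \<in> J l then z j else False) \<in> measurable (PiM (J l) ?M) (PiM UNIV ?M)"
    proof (rule measurable_restrict)
      show "(\<lambda>z. if j \<in> J l then z j else False) \<in> measurable (PiM (J l) ?M) (?M j)" for j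
      proof (cases "j \<in> J l")
        case True
        then show ?thesis using measurable_component_singleton[OF True, of ?M] by (simp only: if_True)
      qed simp
    qed
    then show ?thesis by (simp add: ext_def cantor_measure_def restrict_def)
  qed
  then have B: "B l \<in> sets (PiM (J l) ?M)" if "l \<in> L" for l
    unfolding B_def using E[OF that] by (rule measurable_sets)
  have eq: "(\<lambda>Y. restrict (\<lambda>i. Y i) (J l)) -` B l \<inter> space cantor_measure = E l" if "l \<in> L" for l
  proof -
    have ext: "ext l (restrict Y (J l)) j = Y j" if "j \<in> J l" for Y j
      using that by (simp add: ext_def)
    have "ext l (restrict Y (J l)) \<in> E l \<longleftrightarrow> Y \<in> E l" for Y
      using dep[OF that, of Y "ext l (restrict Y (J l))"] dep[OF that, of "ext l (restrict Y (J l))" Y] ext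
      by metis
    then show ?thesis by (auto simp: B_def space_PiM)
  qed
  have "cantor.indep_vars (\<lambda>l. PiM (J l) ?M) (\<lambda>l Y. restrict (\<lambda>i. Y i) (J l)) L"
    by (rule cantor.indep_vars_restrict[OF cantor_indep_components]) (use J in auto)
  from cantor.indep_varsD_finite[OF this L(2,1) B] show ?thesis
    by (simp only: eq cong: prod.cong INF_cong)
qed

lemma prob_Int_disjoint_support:
  assumes "E \<in> sets cantor_measure" "F \<in> sets cantor_measure"
    and "\<And>Y Y'. (\<And>j. j < t \<Longrightarrow> Y j = Y' j) \<Longrightarrow> Y \<in> E \<Longrightarrow> Y' \<in> E"
    and "\<And>Y Y'. (\<And>j. t \<le> j \<Longrightarrow> Y j = Y' j) \<Longrightarrow> Y \<in> F \<Longrightarrow> Y' \<in> F"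
  shows "cantor.prob (E \<inter> F) = cantor.prob E * cantor.prob F"
proof -
  have "cantor.prob (\<Inter>b\<in>UNIV. if b then E else F) = (\<Prod>b\<in>UNIV. cantor.prob (if b then E else F))"
  proof (rule prob_Inter_disjoint_support[where J="\<lambda>b. if b then {..<t} else {t..}"])
    show "disjoint_family_on (\<lambda>b. if b then {..<t} else {t..}) UNIV"
      by (auto simp: disjoint_family_on_def)
    show "(if b then E else F) \<in> sets cantor_measure" for b using assms by simp
    show "Y' \<in> (if b then E else F)" 
      if "\<And>j. j \<in> (if b then {..<t} else {t..}) \<Longrightarrow> Y j = Y' j" "Y \<in> (if b then E else F)" for b Y Y'
      using that assms(3)[of Y Y'] assms(4)[of Y Y'] by (cases b) auto
  qed auto
  then show ?thesis by (simp add: UNIV_bool Int_commute mult.commute)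
qed

section \<open>Sparse returns to an open set\<close>

text \<open>\<open>\<phi> i n\<close> is the coordinate change on Cantor space induced by the \<open>n\<close>-th power of the \<open>i\<close>-th shift.
  Powers beyond \<open>N t\<close> move every coordinate beyond \<open>t\<close> and move the first \<open>t\<close> coordinates to
  disjoint places.\<close>

locale shift_system =
  fixes k :: nat and \<phi> :: "nat \<Rightarrow> nat \<Rightarrow> nat \<Rightarrow> nat" and N :: "nat \<Rightarrow> nat"
  assumes k_pos: "k \<ge> 1"
    and recursive_phi: "\<And>i. i < k \<Longrightarrow> recursive (\<lambda>e. \<phi> i (e 0) (e 1))"
    and recursive_N: "recursive (\<lambda>e. N (e 0))"
    and inj_phi: "\<And>i n. i < k \<Longrightarrow> inj (\<phi> i n)"
    and phi_ge: "\<And>i n t j. i < k \<Longrightarrow> N t \<le> n \<Longrightarrow> t \<le> \<phi> i n j"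
    and phi_disjoint: "\<And>i i' n t j j'. i < k \<Longrightarrow> i' < k \<Longrightarrow> N t \<le> n \<Longrightarrow> j < t \<Longrightarrow> j' < t \<Longrightarrow>
      \<phi> i n j = \<phi> i' n j' \<Longrightarrow> i = i'"

locale open_target = shift_system +
  fixes W :: "nat \<Rightarrow> nat \<Rightarrow> bool"
  assumes decidable_W: "decidable (\<lambda>e. W (e 0) (e 1))"
    and W_mono: "\<And>Y s t. s \<le> t \<Longrightarrow> W s (prefix_code Y s) \<Longrightarrow> W t (prefix_code Y t)"
begin

section \<open>Bad sets and a uniform bound for their measure\<close>

definition stage :: "nat \<Rightarrow> (nat \<Rightarrow> bool) set" where
  "stage t = {Y. W t (prefix_code Y t)}"

definition target :: "(nat \<Rightarrow> bool) set" where
  "target = {Y. \<exists>t. W t (prefix_code Y t)}"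

definition bad :: "nat \<Rightarrow> (nat \<Rightarrow> bool) set" where
  "bad n = {Y. \<exists>i<k. (\<lambda>j. Y (\<phi> i n j)) \<in> target}"

text \<open>The sum rebuilds the first \<open>s\<close> bits of the shifted sequence from the bits
  of \<open>x\<close>; \<open>\<phi> i n j < t\<close> ensures that all of them lie within the
  prefix of length \<open>t\<close>.\<close>

definition seen :: "nat \<Rightarrow> nat \<Rightarrow> nat \<Rightarrow> bool" where
  "seen n t x \<longleftrightarrow> (\<exists>i<k. \<exists>s\<le>t. (\<forall>j<s. \<phi> i n j < t) \<and>
    W s (\<Sum>j<s. of_bool (odd (x div 2 ^ \<phi> i n j)) * 2 ^ j))"

lemma target_eq_Union: "target = (\<Union>t. stage t)"
  by (auto simp: target_def stage_def)

lemma stage_mono: "s \<le> t \<Longrightarrow> stage s \<subseteq> stage t"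
  using W_mono by (auto simp: stage_def)

lemma sets_stage [measurable]: "stage t \<in> sets cantor_measure"
  unfolding stage_def by (rule sets_prefix_class)

lemma sets_target [measurable]: "target \<in> sets cantor_measure"
  unfolding target_def by (rule sets_ex_prefix_class)

lemma bad_eq_Union: "bad n = (\<Union>i<k. {Y. (\<lambda>j. Y (\<phi> i n j)) \<in> target})"
  by (auto simp: bad_def)

lemma sets_bad [measurable]: "bad n \<in> sets cantor_measure"
  unfolding bad_eq_Union by (intro sets.finite_UN sets_reindex sets_target) auto

lemma seen_prefix_code:
  "seen n t (prefix_code Y t) \<longleftrightarrow>
    (\<exists>i<k. \<exists>s\<le>t. (\<forall>j<s. \<phi> i n j < t) \<and> W s (prefix_code (\<lambda>j. Y (\<phi> i n j)) s))"
proof -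
  have "(\<Sum>j<s. of_bool (odd (prefix_code Y t div 2 ^ \<phi> i n j)) * 2 ^ j) = prefix_code (\<lambda>j. Y (\<phi> i n j)) s"
    if "\<forall>j<s. \<phi> i n j < t" for i s
    unfolding prefix_code_sum[of "\<lambda>j. Y (\<phi> i n j)"]
    by (rule sum.cong) (use that odd_prefix_code_div in auto)
  then show ?thesis unfolding seen_def by (metis (no_types, lifting))
qed

lemma seen_mono:
  assumes "t \<le> t'" "seen n t (prefix_code Y t)"
  shows "seen n t' (prefix_code Y t')"
  using assms unfolding seen_prefix_code by (meson le_trans less_le_trans)

lemma bad_iff_seen: "Y \<in> bad n \<longleftrightarrow> (\<exists>t. seen n t (prefix_code Y t))"
proof
  assume "Y \<in> bad n"
  then obtain i s where i: "i < k" and s: "W s (prefix_code (\<lambda>j. Y (\<phi> i n j)) s)"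
    by (auto simp: bad_def target_def)
  define t where "t = s + (\<Sum>j<s. Suc (\<phi> i n j))"
  have "\<phi> i n j < t" if "j < s" for j
    using member_le_sum[of j "{..<s}" "\<lambda>j. Suc (\<phi> i n j)"] that by (simp add: t_def)
  moreover have "s \<le> t" by (simp add: t_def)
  ultimately have "seen n t (prefix_code Y t)"
    unfolding seen_prefix_code using i s by blast
  then show "\<exists>t. seen n t (prefix_code Y t)" ..
next
  assume "\<exists>t. seen n t (prefix_code Y t)"
  then show "Y \<in> bad n" unfolding seen_prefix_code by (auto simp: bad_def target_def)
qed

text \<open>The excess is covered by \<open>k\<close> shifted copies of
  \<open>target - stage t\<close>, each with the measure of that set.\<close>

lemma prob_bad_diff:
  "cantor.prob (bad n - {Y. \<exists>i<k. (\<lambda>j. Y (\<phi> i n j)) \<in> stage t})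
    \<le> real k * (cantor.prob target - cantor.prob (stage t))"
proof -
  have sub: "stage t \<subseteq> target" by (auto simp: target_eq_Union)
  have sD: "{Y. (\<lambda>j. Y (\<phi> i n j)) \<in> target - stage t} \<in> sets cantor_measure" for i
    by (intro sets_reindex sets.Diff sets_target sets_stage)
  have sU: "(\<Union>i<k. {Y. (\<lambda>j. Y (\<phi> i n j)) \<in> target - stage t}) \<in> sets cantor_measure"
    by (rule sets.finite_UN[OF _ sD]) simp
  have "cantor.prob (bad n - {Y. \<exists>i<k. (\<lambda>j. Y (\<phi> i n j)) \<in> stage t})
    \<le> cantor.prob (\<Union>i<k. {Y. (\<lambda>j. Y (\<phi> i n j)) \<in> target - stage t})"
    by (rule cantor.finite_measure_mono[OF _ sU]) (auto simp: bad_def)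
  also have "\<dots> \<le> (\<Sum>i<k. cantor.prob {Y. (\<lambda>j. Y (\<phi> i n j)) \<in> target - stage t})"
    by (rule cantor.finite_measure_subadditive_finite) (use sD in auto)
  also have "\<dots> = (\<Sum>i<k. cantor.prob target - cantor.prob (stage t))"
    by (intro sum.cong refl, subst prob_reindex)
       (auto intro!: inj_phi cantor.finite_measure_Diff[OF sets_target sets_stage sub] sets.Diff)
  finally show ?thesis by simp
qed

lemma stage_limit:
  assumes "\<epsilon> > 0"
  obtains t where "cantor.prob target - cantor.prob (stage t) < \<epsilon>"
proof -
  have "(\<lambda>t. cantor.prob (stage t)) \<longlonglongrightarrow> cantor.prob (\<Union>t. stage t)"
    by (rule cantor.finite_Lim_measure_incseq) (auto simp: incseq_def dest: stage_mono)
  then have "eventually (\<lambda>t. cantor.prob (stage t) > cantor.prob target - \<epsilon>) sequentially"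
    unfolding target_eq_Union[symmetric] by (rule order_tendstoD) (use assms in simp)
  then obtain t where "cantor.prob (stage t) > cantor.prob target - \<epsilon>"
    using eventually_happens' sequentially_bot by blast
  then show ?thesis by (intro that[of t]) simp
qed

text \<open>For \<open>N t \<le> n\<close> the \<open>k\<close> shifts move the first
  \<open>t\<close> coordinates to disjoint places, so with probability at least \<open>p ^ k\<close>
  all of them avoid \<open>stage t\<close>. What \<open>bad n\<close> has beyond that stage is
  bounded by \<open>prob_bad_diff\<close>.\<close>

lemma prob_bad_bound:
  assumes "cantor.prob target < 1"
  obtains c n0 where "0 \<le> c" "c < 1" "\<And>n. n0 \<le> n \<Longrightarrow> cantor.prob (bad n) \<le> c"
proof -
  define p where "p = 1 - cantor.prob target"
  have p: "0 < p" "p \<le> 1" using assms by (auto simp: p_def)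
  \<comment> \<open>The tolerance is such that \<open>k\<close> times it is half of
    \<open>p ^ k\<close>.\<close>
  obtain t where t: "cantor.prob target - cantor.prob (stage t) < p ^ k / (2 * real k)"
    using stage_limit[of "p ^ k / (2 * real k)"] p k_pos by auto
  have bound: "cantor.prob (bad n) \<le> 1 - p ^ k / 2" if n: "N t \<le> n" for n
  proof -
    let ?C = "\<lambda>i. {Y. (\<lambda>j. Y (\<phi> i n j)) \<in> - stage t}"
    let ?B = "{Y. \<exists>i<k. (\<lambda>j. Y (\<phi> i n j)) \<in> stage t}"
    have sC: "- stage t \<in> sets cantor_measure"
      using sets.compl_sets[OF sets_stage[of t]] by (simp add: Compl_eq_Diff_UNIV)
    have setsC: "?C i \<in> sets cantor_measure" for i
      by (rule sets_reindex[OF sC])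
    have "cantor.prob (\<Inter>i\<in>{..<k}. ?C i) = (\<Prod>i\<in>{..<k}. cantor.prob (?C i))"
    proof (rule prob_Inter_disjoint_support[where J="\<lambda>i. \<phi> i n ` {..<t}"])
      show "disjoint_family_on (\<lambda>i. \<phi> i n ` {..<t}) {..<k}"
        unfolding disjoint_family_on_def using phi_disjoint[OF _ _ n] by blast
      show "Y' \<in> ?C i" if "i \<in> {..<k}" "\<And>j. j \<in> \<phi> i n ` {..<t} \<Longrightarrow> Y j = Y' j" "Y \<in> ?C i" for i Y Y'
      proof -
        have "prefix_code (\<lambda>j. Y (\<phi> i n j)) t = prefix_code (\<lambda>j. Y' (\<phi> i n j)) t"
          by (rule prefix_code_cong) (use that(2) in auto)
        then show ?thesis using that(3) by (simp add: stage_def)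
      qed
    qed (use k_pos setsC in \<open>auto simp: lessThan_empty_iff\<close>)
    also have "\<dots> = (\<Prod>i\<in>{..<k}. 1 - cantor.prob (stage t))"
    proof (rule prod.cong)
      fix i assume "i \<in> {..<k}"
      then show "cantor.prob (?C i) = 1 - cantor.prob (stage t)"
        using prob_reindex[OF inj_phi sC, of i n] cantor.prob_compl[OF sets_stage[of t]]
        by (simp add: Compl_eq_Diff_UNIV)
    qed simp
    also have "\<dots> \<ge> (\<Prod>i\<in>{..<k}. p)"
    proof (rule prod_mono)
      have "cantor.prob (stage t) \<le> cantor.prob target"
        by (rule cantor.finite_measure_mono) (auto simp: target_eq_Union[symmetric] sets_target, auto simp: target_eq_Union)
      then show "0 \<le> p \<and> p \<le> 1 - cantor.prob (stage t)" for i using p by (simp add: p_def)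
    qed
    finally have "p ^ k \<le> cantor.prob (\<Inter>i\<in>{..<k}. ?C i)" by simp
    moreover have "?B = space cantor_measure - (\<Inter>i\<in>{..<k}. ?C i)" by auto
    moreover have int: "(\<Inter>i\<in>{..<k}. ?C i) \<in> sets cantor_measure"
      using k_pos setsC by (intro sets.finite_INT) (auto simp: lessThan_empty_iff)
    ultimately have B: "cantor.prob ?B \<le> 1 - p ^ k" and sB: "?B \<in> sets cantor_measure"
      using cantor.prob_compl[OF int] sets.compl_sets[OF int] by simp_all
    have "cantor.prob (bad n) \<le> cantor.prob (?B \<union> (bad n - ?B))"
      by (rule cantor.finite_measure_mono) (use sB in auto)
    also have "\<dots> \<le> cantor.prob ?B + cantor.prob (bad n - ?B)"
      by (rule measure_Un_le) (use sB in auto)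
    also have "\<dots> \<le> (1 - p ^ k) + real k * (p ^ k / (2 * real k))"
      by (intro add_mono B order_trans[OF prob_bad_diff] mult_left_mono less_imp_le[OF t]) simp
    also have "\<dots> = 1 - p ^ k / 2" using k_pos by (simp add: field_simps)
    finally show ?thesis .
  qed
  have "0 < p ^ k" "p ^ k \<le> 1" using p by (auto intro: power_le_one)
  then show ?thesis by (intro that[of "1 - p ^ k / 2" "N t"] bound) auto
qed

end

text \<open>The counter \<open>jumps Y t\<close> is the length of a sequence of times \<open>0 = t\<^sub>0 < \<dots> < t\<^sub>r \<le> t\<close>, where
  \<open>t\<^sub>i\<^sub>+\<^sub>1\<close> is the first time after \<open>t\<^sub>i\<close> at which \<open>Y\<close> is seen to be bad for the power \<open>N t\<^sub>i + n0\<close>, and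
  \<open>last_jump Y t\<close> is \<open>t\<^sub>r\<close>. That power reads only coordinates beyond \<open>t\<^sub>i\<close>, so each further jump costs a factor \<open>c\<close>.\<close>

locale sparse_returns = open_target +
  fixes n0 :: nat and c :: real
  assumes c: "0 \<le> c" "c < 1" and prob_bad_le: "\<And>n. n0 \<le> n \<Longrightarrow> cantor.prob (bad n) \<le> c"
    and n0_pos: "1 \<le> n0"
begin

definition next_pow :: "nat \<Rightarrow> nat" where
  "next_pow t = N t + n0"

primrec last_jump :: "(nat \<Rightarrow> bool) \<Rightarrow> nat \<Rightarrow> nat" where
  "last_jump Y 0 = 0"
| "last_jump Y (Suc t) = (if seen (next_pow (last_jump Y t)) (Suc t) (prefix_code Y (Suc t)) then Suc t else last_jump Y t)"

definition jumps :: "(nat \<Rightarrow> bool) \<Rightarrow> nat \<Rightarrow> nat" where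
  "jumps Y t = (\<Sum>s<t. of_bool (last_jump Y (Suc s) = Suc s))"

definition G :: "nat \<Rightarrow> (nat \<Rightarrow> bool) set" where
  "G r = {Y. \<exists>t. r \<le> jumps Y t}"

text \<open>The event that the \<open>r\<close>-th jump happens exactly at time \<open>t\<close>;
  the start counts as jump number 0, so \<open>F 0 0\<close> is the whole space.\<close>

definition F :: "nat \<Rightarrow> nat \<Rightarrow> (nat \<Rightarrow> bool) set" where
  "F r t = {Y. jumps Y t = r \<and> last_jump Y t = t}"

text \<open>The recursion of \<open>last_jump\<close>, run on a number whose shorter prefixes are
  obtained by reduction modulo powers of 2. It shows that the counters are recursive and depend on
  finitely many coordinates.\<close>

definition last_jump_code :: "nat \<Rightarrow> nat \<Rightarrow> nat" where
  "last_jump_code x t = rec_nat 0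
    (\<lambda>s l. if seen (next_pow l) (Suc s) (x mod 2 ^ Suc s) then Suc s else l) t"

definition jumps_code :: "nat \<Rightarrow> nat \<Rightarrow> nat" where
  "jumps_code x t = (\<Sum>s<t. of_bool (last_jump_code x (Suc s) = Suc s))"

lemma last_jump_code: "t \<le> T \<Longrightarrow> last_jump_code (prefix_code Y T) t = last_jump Y t"
proof (induction t)
  case (Suc t)
  then show ?case using prefix_code_mod[of "Suc t" T Y]
    by (simp add: last_jump_code_def del: power_Suc)
qed (simp add: last_jump_code_def)

lemma jumps_code: "jumps_code (prefix_code Y t) t = jumps Y t"
  unfolding jumps_code_def jumps_def by (rule sum.cong) (auto simp: last_jump_code simp del: last_jump.simps)

lemma last_jump_le: "last_jump Y t \<le> t"
  by (induction t) auto

lemma jumps_0 [simp]: "jumps Y 0 = 0"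
  by (simp add: jumps_def)

lemma jumps_Suc: "jumps Y (Suc t) = jumps Y t + of_bool (last_jump Y (Suc t) = Suc t)"
  by (simp add: jumps_def del: last_jump.simps)

lemma jumps_mono: "s \<le> t \<Longrightarrow> jumps Y s \<le> jumps Y t"
  unfolding jumps_def by (intro sum_mono2) auto

lemma last_jump_Suc_eq:
  "last_jump Y (Suc t) = Suc t \<longleftrightarrow> seen (next_pow (last_jump Y t)) (Suc t) (prefix_code Y (Suc t))"
  using last_jump_le[of Y t] by auto

lemma last_jump_stay: "t \<le> t1 \<Longrightarrow> jumps Y t1 = jumps Y t \<Longrightarrow> last_jump Y t1 = last_jump Y t"
proof (induction t1 rule: dec_induct)
  case (step t1)
  then have "jumps Y t1 = jumps Y t" "last_jump Y (Suc t1) \<noteq> Suc t1"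
    using jumps_mono[of t t1 Y] by (auto simp: jumps_Suc simp del: last_jump.simps split: if_splits)
  with step.IH show ?case by (auto split: if_splits)
qed simp

lemma seen_before_jump:
  "t \<le> t1 \<Longrightarrow> jumps Y t < jumps Y t1 \<Longrightarrow>
    \<exists>t'. t < t' \<and> t' \<le> t1 \<and> seen (next_pow (last_jump Y t)) t' (prefix_code Y t')"
proof (induction t1 rule: dec_induct)
  case (step t1)
  show ?case
  proof (cases "jumps Y t < jumps Y t1")
    case True
    with step.IH show ?thesis using le_Suc_eq by blast
  next
    case False
    then have eq: "jumps Y t1 = jumps Y t" using jumps_mono[OF step.hyps(1), of Y] by simp
    with step.prems have "last_jump Y (Suc t1) = Suc t1"
      by (auto simp: jumps_Suc simp del: last_jump.simps split: if_splits)
    then show ?thesis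
      using last_jump_stay[OF step.hyps(1) eq] step.hyps(1) unfolding last_jump_Suc_eq
      by (intro exI[of _ "Suc t1"]) auto
  qed
qed simp

text \<open>Without a jump before \<open>t'\<close>, the power under test is still the one chosen by
  time \<open>t\<close>, and its being seen at \<open>t'\<close> forces a jump there.\<close>

lemma jump_if_seen:
  assumes "t < t'" "seen (next_pow (last_jump Y t)) t' (prefix_code Y t')"
  shows "jumps Y t < jumps Y t'"
proof (rule ccontr)
  assume neg: "\<not> ?thesis"
  obtain s where s: "t' = Suc s" "t \<le> s" using assms(1) by (cases t') auto
  have "jumps Y s = jumps Y t"
    using neg jumps_mono[OF s(2), of Y] jumps_mono[of s "Suc s" Y] s by simp
  then have "last_jump Y s = last_jump Y t" by (rule last_jump_stay[OF s(2)])
  then have "last_jump Y (Suc s) = Suc s" using assms(2) s(1) last_jump_Suc_eq by simp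
  then have "jumps Y (Suc s) = Suc (jumps Y t)"
    using \<open>jumps Y s = jumps Y t\<close> by (simp add: jumps_Suc del: last_jump.simps)
  then show False using neg s by simp
qed

text \<open>The counter starts at 0 and grows by at most one per step, so when it first reaches
  \<open>r\<close> its value is exactly \<open>r\<close> and, unless that time is 0, a jump occurs
  then.\<close>

lemma G_eq_Union: "G r = (\<Union>t. F r t)"
proof (intro equalityI subsetI)
  fix Y assume "Y \<in> G r"
  then have ex: "\<exists>t. r \<le> jumps Y t" by (simp add: G_def)
  define t where "t = (LEAST t. r \<le> jumps Y t)"
  have t: "r \<le> jumps Y t" unfolding t_def by (rule LeastI_ex[OF ex])
  have "Y \<in> F r t"
  proof (cases t)
    case 0
    with t show ?thesis by (simp add: F_def)
  next
    case (Suc s)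
    then have "jumps Y s < r" using not_less_Least[of s "\<lambda>t. r \<le> jumps Y t"] by (simp add: t_def)
    with t Suc show ?thesis
      by (cases "last_jump Y (Suc s) = Suc s") (auto simp: F_def jumps_Suc simp del: last_jump.simps)
  qed
  then show "Y \<in> (\<Union>t. F r t)" by blast
next
  show "Y \<in> G r" if "Y \<in> (\<Union>t. F r t)" for Y
    using that unfolding F_def G_def by auto
qed

lemma disjoint_F: "disjoint_family (F r)"
proof -
  have "t = t'" if "Y \<in> F r t" "Y \<in> F r t'" "t \<le> t'" for Y t t'
    using that last_jump_stay[of t t' Y] by (simp add: F_def)
  then show ?thesis
    unfolding disjoint_family_on_def by (metis disjoint_iff nat_le_linear)
qed

lemma F_prefix: "F r t = {Y. jumps_code (prefix_code Y t) t = r \<and> last_jump_code (prefix_code Y t) t = t}"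
  by (simp add: F_def jumps_code last_jump_code)

lemma sets_F [measurable]: "F r t \<in> sets cantor_measure"
  unfolding F_prefix by (rule sets_prefix_class)

lemma sets_G [measurable]: "G r \<in> sets cantor_measure"
  unfolding G_eq_Union by auto

lemma G_Suc_subset: "G (Suc r) \<subseteq> (\<Union>t. F r t \<inter> bad (next_pow t))"
proof
  fix Y assume "Y \<in> G (Suc r)"
  then obtain t1 where t1: "Suc r \<le> jumps Y t1" by (auto simp: G_def)
  then have "Y \<in> G r" by (auto simp: G_def intro: Suc_leD)
  then obtain t where t: "Y \<in> F r t" by (auto simp: G_eq_Union)
  then have "jumps Y t < jumps Y t1" using t1 by (simp add: F_def)
  then have "t \<le> t1" using jumps_mono[of t1 t Y] by (meson leD nat_le_linear)
  with t \<open>jumps Y t < jumps Y t1\<close> have "Y \<in> bad (next_pow t)"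
    using seen_before_jump[of t t1 Y] by (auto simp: bad_iff_seen F_def)
  with t show "Y \<in> (\<Union>t. F r t \<inter> bad (next_pow t))" by blast
qed

text \<open>\<open>F r t\<close> is decided by the first \<open>t\<close> coordinates, while
  \<open>next_pow t \<ge> N t\<close> makes \<open>bad (next_pow t)\<close> read only coordinates
  from \<open>t\<close> on.\<close>

lemma prob_F_Int_bad: "cantor.prob (F r t \<inter> bad (next_pow t)) = cantor.prob (F r t) * cantor.prob (bad (next_pow t))"
proof (rule prob_Int_disjoint_support)
  show "Y' \<in> F r t" if "\<And>j. j < t \<Longrightarrow> Y j = Y' j" "Y \<in> F r t" for Y Y'
  proof -
    have "prefix_code Y t = prefix_code Y' t" by (rule prefix_code_cong) (rule that)
    with that(2) show ?thesis unfolding F_prefix by simp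
  qed
  show "Y' \<in> bad (next_pow t)" if "\<And>j. t \<le> j \<Longrightarrow> Y j = Y' j" "Y \<in> bad (next_pow t)" for Y Y'
  proof -
    have "(\<lambda>j. Y (\<phi> i (next_pow t) j)) = (\<lambda>j. Y' (\<phi> i (next_pow t) j))" if "i < k" for i
      using \<open>\<And>j. t \<le> j \<Longrightarrow> Y j = Y' j\<close> phi_ge[OF that, of t "next_pow t"] by (simp add: next_pow_def)
    with that(2) show ?thesis unfolding bad_def by auto
  qed
qed auto

text \<open>The sets \<open>F r t\<close> partition \<open>G r\<close> by the time of the
  \<open>r\<close>-th jump, and on each piece one further jump costs a factor at most
  \<open>c\<close>.\<close>

lemma prob_G_Suc: "cantor.prob (G (Suc r)) \<le> c * cantor.prob (G r)"
proof -
  have 1: "(\<lambda>t. cantor.prob (F r t)) sums cantor.prob (\<Union>t. F r t)"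
    by (rule cantor.finite_measure_UNION) (use disjoint_F in auto)
  have 2: "(\<lambda>t. cantor.prob (F r t \<inter> bad (next_pow t))) sums cantor.prob (\<Union>t. F r t \<inter> bad (next_pow t))"
    by (rule cantor.finite_measure_UNION)
       (use disjoint_F[of r] in \<open>auto simp: disjoint_family_on_def\<close>)
  have "cantor.prob (G (Suc r)) \<le> cantor.prob (\<Union>t. F r t \<inter> bad (next_pow t))"
    by (rule cantor.finite_measure_mono[OF G_Suc_subset]) auto
  also have "\<dots> \<le> c * cantor.prob (\<Union>t. F r t)"
  proof (rule sums_le[OF _ 2 sums_mult[OF 1]])
    show "cantor.prob (F r t \<inter> bad (next_pow t)) \<le> c * cantor.prob (F r t)" for t
      unfolding prob_F_Int_bad mult.commute[of c]
      by (intro mult_left_mono prob_bad_le) (auto simp: next_pow_def)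
  qed
  finally show ?thesis by (simp add: G_eq_Union)
qed

lemma prob_G: "cantor.prob (G r) \<le> c ^ r"
proof (induction r)
  case (Suc r)
  show ?case
    using order_trans[OF prob_G_Suc mult_left_mono[OF Suc c(1)]] by simp
qed simp

lemma always_bad_in_G:
  assumes "\<And>n. 1 \<le> n \<Longrightarrow> Y \<in> bad n"
  shows "Y \<in> G r"
proof (induction r)
  case (Suc r)
  then obtain t where t: "Y \<in> F r t" by (auto simp: G_eq_Union)
  have "Y \<in> bad (next_pow t)" using n0_pos by (intro assms) (simp add: next_pow_def)
  then obtain t' where "seen (next_pow t) t' (prefix_code Y t')" by (auto simp: bad_iff_seen)
  \<comment> \<open>The maximum places the sighting strictly after the jump at \<open>t\<close>;
    what a prefix shows, its extensions show too.\<close>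
  then have "seen (next_pow t) (max t' (Suc t)) (prefix_code Y (max t' (Suc t)))"
    by (rule seen_mono[rotated]) simp
  then have "jumps Y t < jumps Y (max t' (Suc t))"
    using t by (intro jump_if_seen) (auto simp: F_def)
  with t show ?case by (auto simp: G_def F_def Suc_le_eq)
qed (auto simp: G_def)

lemma prob_always_bad: "cantor.prob {Y. \<forall>n\<ge>1. Y \<in> bad n} = 0"
proof (rule LIMSEQ_le_const[THEN antisym[OF _ measure_nonneg], of "\<lambda>r. c ^ r"])
  show "(\<lambda>r. c ^ r) \<longlonglongrightarrow> 0" using c by (intro LIMSEQ_realpow_zero)
  have "cantor.prob {Y. \<forall>n\<ge>1. Y \<in> bad n} \<le> c ^ r" for r
    by (rule order_trans[OF cantor.finite_measure_mono prob_G]) (use always_bad_in_G in auto)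
  then show "\<exists>N. \<forall>r\<ge>N. cantor.prob {Y. \<forall>n\<ge>1. Y \<in> bad n} \<le> c ^ r" by blast
qed

lemma recursive_phi_comp: "i < k \<Longrightarrow> recursive a \<Longrightarrow> recursive b \<Longrightarrow> recursive (\<lambda>e. \<phi> i (a e) (b e))"
  using recursive_binary[where f="\<phi> i", OF recursive_phi] .

lemma decidable_seen: "decidable (\<lambda>e. seen (e 0) (e 1) (e 2))"
  unfolding seen_def
  by (intro recursive_intros recursive_phi_comp decidable_binary[where P=W, OF decidable_W])

lemma recursive_next_pow: "recursive a \<Longrightarrow> recursive (\<lambda>e. next_pow (a e))"
  unfolding next_pow_def
  by (intro recursive_intros recursive_unary[where f=N, OF recursive_N])

lemma recursive_last_jump_code: "recursive (\<lambda>e. last_jump_code (e 0) (e 1))"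
  unfolding last_jump_code_def
  by (rule recursive_rec[where g="\<lambda>s l e. if seen (next_pow l) (Suc s) (e 0 mod 2 ^ Suc s) then Suc s else l"])
     (intro recursive_intros recursive_next_pow decidable_ternary[where P=seen, OF decidable_seen])+

lemma recursive_jumps_code: "recursive (\<lambda>e. jumps_code (e 0) (e 1))"
  unfolding jumps_code_def
  by (intro recursive_intros recursive_binary[where f=last_jump_code, OF recursive_last_jump_code])

end

section \<open>The tests\<close>

context sparse_returns
begin

text \<open>\<open>L\<close> jumps together cost a factor at most 1/2, so every \<open>L\<close>-th
  level has the measure bound of a test.\<close>

lemma Martin_Loef_test_G:
  assumes "c ^ L \<le> 1 / 2"
  shows "Martin_Loef_test (\<lambda>m. G (L * m))"
  unfolding Martin_Loef_test_def
proof (intro conjI allI)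
  have "decidable (\<lambda>e. L * e 0 \<le> jumps_code (e 2) (e 1))"
    by (intro recursive_intros recursive_binary[where f=jumps_code, OF recursive_jumps_code])
  from uniformly_Sigma01_decidable[OF this]
  show "uniformly_Sigma01 (\<lambda>m. G (L * m))" by (simp add: G_def jumps_code)
  show "cantor.prob (G (L * m)) \<le> (1 / 2) ^ m" for m
    using prob_G[of "L * m"] power_mono[OF assms, of m] c by (simp add: power_mult)
qed

text \<open>If \<open>T\<close> bits decide \<open>target\<close>, they also confirm avoidance of
  it. So \<open>Y \<notin> bad n\<close> is visible on a prefix containing \<open>T\<close> bits of
  each of the \<open>k\<close> shifts, and searching for such an \<open>n\<close> makes the
  complement effectively open.\<close>

lemma Pi01_class_always_bad:
  assumes "target = stage T"
  shows "Pi01_class {Y. \<forall>n\<ge>1. Y \<in> bad n}"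
proof -
  define D where "D t x \<longleftrightarrow> (\<exists>n\<le>t. 1 \<le> n \<and> (\<forall>i<k. (\<forall>j<T. \<phi> i n j < t) \<and>
    \<not> W T (\<Sum>j<T. of_bool (odd (x div 2 ^ \<phi> i n j)) * 2 ^ j)))" for t x :: nat
  have "decidable (\<lambda>e. D (e 0) (e 1))" unfolding D_def
    by (intro recursive_intros recursive_phi_comp decidable_binary[where P=W, OF decidable_W])
  moreover have "- {Y. \<forall>n\<ge>1. Y \<in> bad n} = {Y. \<exists>t. D t (prefix_code Y t)}"
  proof -
    have code: "(\<Sum>j<T. of_bool (odd (prefix_code Y t div 2 ^ \<phi> i n j)) * 2 ^ j) = prefix_code (\<lambda>j. Y (\<phi> i n j)) T"
      if "\<forall>j<T. \<phi> i n j < t" for i n t Y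
      unfolding prefix_code_sum[of "\<lambda>j. Y (\<phi> i n j)"]
      by (rule sum.cong) (use that odd_prefix_code_div in auto)
    have bad: "Y \<notin> bad n \<longleftrightarrow> (\<forall>i<k. \<not> W T (prefix_code (\<lambda>j. Y (\<phi> i n j)) T))" for Y n
      by (auto simp: bad_def assms stage_def)
    have "(\<exists>n\<ge>1. Y \<notin> bad n) \<longleftrightarrow> (\<exists>t. D t (prefix_code Y t))" for Y
    proof
      assume "\<exists>n\<ge>1. Y \<notin> bad n"
      then obtain n where n: "n \<ge> 1" "Y \<notin> bad n" by blast
      define t where "t = n + (\<Sum>i<k. \<Sum>j<T. Suc (\<phi> i n j))"
      have less: "\<phi> i n j < t" if "i < k" "j < T" for i j
      proof -
        have "Suc (\<phi> i n j) \<le> (\<Sum>j<T. Suc (\<phi> i n j))"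
          using that by (intro member_le_sum[of j "{..<T}" "\<lambda>j. Suc (\<phi> i n j)"]) auto
        also have "\<dots> \<le> (\<Sum>i<k. \<Sum>j<T. Suc (\<phi> i n j))"
          using that by (intro member_le_sum[of i "{..<k}" "\<lambda>i. \<Sum>j<T. Suc (\<phi> i n j)"]) auto
        finally show ?thesis by (simp add: t_def)
      qed
      have "D t (prefix_code Y t)" unfolding D_def
      proof (intro exI[of _ n] conjI allI impI)
        show "n \<le> t" by (simp add: t_def)
        show "\<not> W T (\<Sum>j<T. of_bool (odd (prefix_code Y t div 2 ^ \<phi> i n j)) * 2 ^ j)" if "i < k" for i
          using n(2) that less code[of i n t Y] unfolding bad by simp
      qed (use n less in auto)
      then show "\<exists>t. D t (prefix_code Y t)" ..
    next
      assume "\<exists>t. D t (prefix_code Y t)"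
      then obtain t n where n: "1 \<le> n" and *: "\<And>i. i < k \<Longrightarrow> (\<forall>j<T. \<phi> i n j < t) \<and>
          \<not> W T (\<Sum>j<T. of_bool (odd (prefix_code Y t div 2 ^ \<phi> i n j)) * 2 ^ j)"
        unfolding D_def by blast
      have "Y \<notin> bad n" unfolding bad using * code by metis
      with n show "\<exists>n\<ge>1. Y \<notin> bad n" by blast
    qed
    then show ?thesis by auto
  qed
  ultimately show ?thesis
    unfolding Pi01_class_def using Sigma01_class_decidable[of D] by simp
qed

end

locale computable_sparse_returns = sparse_returns +
  fixes h :: "nat \<Rightarrow> nat"
  assumes recursive_h: "recursive (\<lambda>e. h (e 0))"
    and h: "\<And>d. cantor.prob target - cantor.prob (stage (h d)) \<le> (1 / 2) ^ d"
begin

text \<open>By time \<open>modulus d s\<close>, badness for any of the powers selected at a time up to \<open>s\<close> has been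
  seen, up to an error \<open>2\<^sup>-\<^sup>d\<^sup>-\<^sup>s\<close>.\<close>

definition modulus :: "nat \<Rightarrow> nat \<Rightarrow> nat" where
  "modulus d s = Suc (s + h (d + s + k) +
    (\<Sum>s'<Suc s. \<Sum>i<k. \<Sum>j<h (d + s + k). \<phi> i (next_pow s') j))"

text \<open>By \<open>times d r\<close> the first \<open>r\<close> jumps, as far as they ever occur,
  have been observed outside a set of small measure.\<close>

definition times :: "nat \<Rightarrow> nat \<Rightarrow> nat" where
  "times d r = rec_nat 0 (\<lambda>_ s. modulus d s) r"

definition missed :: "nat \<Rightarrow> nat \<Rightarrow> (nat \<Rightarrow> bool) set" where
  "missed s T = bad (next_pow s) - {Y. seen (next_pow s) T (prefix_code Y T)}"

lemma times_Suc: "times d (Suc r) = modulus d (times d r)" "times d 0 = 0"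
  by (simp_all add: times_def)

lemma less_modulus: "s < modulus d s"
  by (simp add: modulus_def)

lemma sets_missed [measurable]: "missed s T \<in> sets cantor_measure"
  unfolding missed_def using sets_prefix_class[of "seen (next_pow s) T" T] by auto

text \<open>The summand \<open>k\<close> in the precision absorbs the union bound over the shifts,
  as \<open>k \<le> 2 ^ k\<close>. The summand \<open>s\<close> is kept for the union over all
  \<open>s' \<le> s\<close> taken in \<open>prob_G_approx\<close>.\<close>

lemma prob_missed:
  assumes "s' \<le> s"
  shows "cantor.prob (missed s' (modulus d s)) \<le> (1 / 2) ^ (d + s)"
proof -
  let ?h = "h (d + s + k)" and ?n = "next_pow s'"
  have less: "\<phi> i ?n j < modulus d s" if "i < k" "j < ?h" for i j
  proof -
    have "\<phi> i ?n j \<le> (\<Sum>j<?h. \<phi> i ?n j)"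
      using that by (intro member_le_sum[of j "{..<?h}" "\<phi> i ?n"]) auto
    also have "\<dots> \<le> (\<Sum>i<k. \<Sum>j<?h. \<phi> i ?n j)"
      using that by (intro member_le_sum[of i "{..<k}" "\<lambda>i. \<Sum>j<?h. \<phi> i ?n j"]) auto
    also have "\<dots> \<le> (\<Sum>s'<Suc s. \<Sum>i<k. \<Sum>j<?h. \<phi> i (next_pow s') j)"
      using assms by (intro member_le_sum[of s' "{..<Suc s}" "\<lambda>s'. \<Sum>i<k. \<Sum>j<?h. \<phi> i (next_pow s') j"]) auto
    finally show ?thesis by (simp add: modulus_def)
  qed
  have "seen ?n (modulus d s) (prefix_code Y (modulus d s))"
    if "i < k" "(\<lambda>j. Y (\<phi> i ?n j)) \<in> stage ?h" for Y i
  proof -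
    have "?h \<le> modulus d s" by (simp add: modulus_def)
    moreover have "W ?h (prefix_code (\<lambda>j. Y (\<phi> i ?n j)) ?h)" using that(2) by (simp add: stage_def)
    ultimately show ?thesis unfolding seen_prefix_code using that(1) less[OF that(1)] by blast
  qed
  then have "missed s' (modulus d s) \<subseteq> bad ?n - {Y. \<exists>i<k. (\<lambda>j. Y (\<phi> i ?n j)) \<in> stage ?h}"
    unfolding missed_def by blast
  moreover have "{Y. \<exists>i<k. (\<lambda>j. Y (\<phi> i ?n j)) \<in> stage ?h} \<in> sets cantor_measure"
  proof -
    have "{Y. \<exists>i<k. (\<lambda>j. Y (\<phi> i ?n j)) \<in> stage ?h} = (\<Union>i<k. {Y. (\<lambda>j. Y (\<phi> i ?n j)) \<in> stage ?h})" by auto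
    then show ?thesis using sets.finite_UN[of "{..<k}", OF _ sets_reindex[OF sets_stage]] by simp
  qed
  ultimately have "cantor.prob (missed s' (modulus d s)) \<le>
      cantor.prob (bad ?n - {Y. \<exists>i<k. (\<lambda>j. Y (\<phi> i ?n j)) \<in> stage ?h})"
    by (intro cantor.finite_measure_mono) auto
  also have "\<dots> \<le> real k * (cantor.prob target - cantor.prob (stage ?h))"
    by (rule prob_bad_diff)
  also have "\<dots> \<le> real k * (1 / 2) ^ (d + s + k)"
    by (intro mult_left_mono h) simp
  also have "\<dots> = (1 / 2) ^ (d + s) * (real k * (1 / 2) ^ k)"
    by (simp add: power_add)
  also have "\<dots> \<le> (1 / 2) ^ (d + s) * 1"
  proof (rule mult_left_mono)
    have "real k \<le> 2 ^ k" using less_exp[of k] by (metis less_imp_le of_nat_le_iff of_nat_numeral of_nat_power)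
    then show "real k * (1 / 2) ^ k \<le> 1" by (simp add: power_one_over field_simps)
  qed simp
  finally show ?thesis by simp
qed

text \<open>Which power is under test at \<open>times d r\<close> depends on \<open>Y\<close>, but
  it was selected at some time up to \<open>times d r\<close>, and the modulus controls all of these
  at once. Outside the missed sets the next jump therefore comes by \<open>times d (Suc r)\<close>
  if it comes at all.\<close>

lemma G_subset_missed:
  "G r \<subseteq> {Y. r \<le> jumps Y (times d r)} \<union> (\<Union>j<r. \<Union>s\<le>times d j. missed s (times d (Suc j)))"
proof (induction r)
  case (Suc r)
  show ?case
  proof
    fix Y assume Y: "Y \<in> G (Suc r)"
    let ?M = "\<lambda>r. \<Union>j<r. \<Union>s\<le>times d j. missed s (times d (Suc j))"
    show "Y \<in> {Y. Suc r \<le> jumps Y (times d (Suc r))} \<union> ?M (Suc r)"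
    proof (cases "Y \<in> ?M (Suc r)")
      case False
      then have not_missed: "Y \<notin> missed s (times d (Suc r))" if "s \<le> times d r" for s
        using that by blast
      have "Y \<notin> ?M r" using False by auto
      moreover have "Y \<in> G r" using Y by (auto simp: G_def intro: Suc_leD)
      ultimately have r: "r \<le> jumps Y (times d r)" using Suc by blast
      have lt: "times d r < times d (Suc r)" by (simp add: times_Suc less_modulus)
      have "Suc r \<le> jumps Y (times d (Suc r))"
      proof (cases "r = jumps Y (times d r)")
        case True
        let ?s = "last_jump Y (times d r)"
        obtain t1 where t1: "jumps Y (times d r) < jumps Y t1"
          using Y True by (auto simp: G_def Suc_le_eq)
        then have "times d r \<le> t1" using jumps_mono[of t1 "times d r" Y] by (meson leD nat_le_linear)
        then have "Y \<in> bad (next_pow ?s)"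
          using seen_before_jump[OF _ t1] by (auto simp: bad_iff_seen)
        then have "seen (next_pow ?s) (times d (Suc r)) (prefix_code Y (times d (Suc r)))"
          using not_missed[of ?s] last_jump_le by (auto simp: missed_def)
        then have "jumps Y (times d r) < jumps Y (times d (Suc r))"
          by (rule jump_if_seen[OF lt])
        with True show ?thesis by simp
      next
        case False
        with r jumps_mono[OF less_imp_le[OF lt], of Y] show ?thesis by simp
      qed
      then show ?thesis by blast
    qed blast
  qed
qed auto

text \<open>A round that starts at time \<open>t\<close> loses at most \<open>t + 1\<close> missed
  sets, each of measure at most \<open>(1 / 2) ^ (d + t)\<close>, hence at most
  \<open>(1 / 2) ^ d\<close> in total.\<close>

lemma prob_G_approx:
  "cantor.prob (G r) - cantor.prob {Y. r \<le> jumps Y (times d r)} \<in> {0..real r * (1 / 2) ^ d}"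
proof -
  let ?A = "{Y. r \<le> jumps Y (times d r)}" and ?M = "\<lambda>j. \<Union>s\<le>times d j. missed s (times d (Suc j))"
  have A: "?A \<in> sets cantor_measure"
    using sets_prefix_class[of "\<lambda>x. r \<le> jumps_code x (times d r)" "times d r"] by (simp add: jumps_code)
  have M: "?M j \<in> sets cantor_measure" for j by (intro sets.finite_UN sets_missed) auto
  have U: "(\<Union>j<r. ?M j) \<in> sets cantor_measure" by (intro sets.finite_UN M) auto
  have "cantor.prob ?A \<le> cantor.prob (G r)"
    by (rule cantor.finite_measure_mono) (auto simp: G_def[symmetric] sets_G, auto simp: G_def)
  moreover have "cantor.prob (G r) \<le> cantor.prob (?A \<union> (\<Union>j<r. ?M j))"
    by (rule cantor.finite_measure_mono[OF G_subset_missed]) (use A U in blast)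
  moreover have "\<dots> \<le> cantor.prob ?A + cantor.prob (\<Union>j<r. ?M j)"
    by (rule measure_Un_le[OF A U])
  moreover have "cantor.prob (\<Union>j<r. ?M j) \<le> (\<Sum>j<r. cantor.prob (?M j))"
    by (rule cantor.finite_measure_subadditive_finite) (use M in auto)
  moreover have "\<dots> \<le> (\<Sum>j<r. (1 / 2) ^ d)"
  proof (rule sum_mono)
    fix j
    let ?t = "times d j"
    have "cantor.prob (?M j) \<le> (\<Sum>s\<le>?t. cantor.prob (missed s (times d (Suc j))))"
      by (rule cantor.finite_measure_subadditive_finite) auto
    also have "\<dots> \<le> (\<Sum>s\<le>?t. (1 / 2) ^ (d + ?t))"
      by (intro sum_mono) (simp add: times_Suc prob_missed)
    also have "\<dots> = (1 / 2) ^ d * (real (Suc ?t) * (1 / 2) ^ ?t)"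
      by (simp add: power_add)
    also have "\<dots> \<le> (1 / 2) ^ d * 1"
    proof (rule mult_left_mono)
      have "real (Suc ?t) \<le> 2 ^ ?t"
        using less_exp[of ?t] by (metis Suc_leI of_nat_le_iff of_nat_numeral of_nat_power)
      then show "real (Suc ?t) * (1 / 2) ^ ?t \<le> 1" by (simp add: power_one_over field_simps)
    qed simp
    finally show "cantor.prob (?M j) \<le> (1 / 2) ^ d" by simp
  qed
  ultimately show ?thesis by simp
qed

lemma recursive_times: "recursive (\<lambda>e. times (e 0) (e 1))"
  unfolding times_def modulus_def
  by (rule recursive_rec[where g="\<lambda>_ s e. Suc (s + h (e 0 + s + k) +
    (\<Sum>s'<Suc s. \<Sum>i<k. \<Sum>j<h (e 0 + s + k). \<phi> i (next_pow s') j))"])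
     (intro recursive_intros recursive_phi_comp recursive_next_pow recursive_unary[where f=h, OF recursive_h]; assumption?)+

text \<open>Having \<open>L * m\<close> jumps by a given computable time is decided by a prefix, so
  its probability is a count of codes divided by a power of 2.\<close>

lemma Schnorr_test_G:
  assumes "c ^ L \<le> 1 / 2"
  shows "Schnorr_test (\<lambda>m. G (L * m))"
proof -
  \<comment> \<open>The error in \<open>prob_G_approx\<close> carries the factor
    \<open>L * m\<close>; the extra precision \<open>L * m\<close> absorbs it.\<close>
  define T where "T m n = times (n + L * m) (L * m)" for m n
  define a where "a m n = (\<Sum>x<2 ^ T m n. of_bool (L * m \<le> jumps_code x (T m n)) :: nat)" for m n
  have T: "recursive (\<lambda>e. T (e 0) (e 1))" unfolding T_def
    by (intro recursive_intros recursive_binary[where f=times, OF recursive_times])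
  note T' = recursive_binary[where f=T, OF T]
  have a: "recursive (\<lambda>e. a (e 0) (e 1))" unfolding a_def
    by (intro recursive_intros T' recursive_binary[where f=jumps_code, OF recursive_jumps_code])
  have den: "recursive (\<lambda>e. 2 ^ T (e 0) (e 1) - 1)" by (intro recursive_intros T')
  have approx: "\<bar>cantor.prob (G (L * m)) - (real (a m n) - real 0) / real (Suc (2 ^ T m n - 1))\<bar> \<le> (1 / 2) ^ n" for m n
  proof -
    have "cantor.prob {Y. L * m \<le> jumps Y (T m n)} = real (a m n) / 2 ^ T m n"
      using prob_prefix_class_sum[of "\<lambda>x. L * m \<le> jumps_code x (T m n)" "T m n"]
      by (simp add: jumps_code a_def)
    moreover have "real (L * m) * (1 / 2) ^ (n + L * m) \<le> (1 / 2) ^ n"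
    proof -
      have "real (L * m) \<le> 2 ^ (L * m)"
        using less_exp[of "L * m"] by (metis less_imp_le of_nat_le_iff of_nat_numeral of_nat_power)
      then show ?thesis by (simp add: power_add power_one_over field_simps)
    qed
    moreover have "real (Suc (2 ^ T m n - 1)) = 2 ^ T m n" by simp
    ultimately show ?thesis
      using prob_G_approx[of "L * m" "n + L * m"] unfolding T_def[symmetric] by simp
  qed
  have "uniformly_computable_reals (\<lambda>m. cantor.prob (G (L * m)))"
    unfolding uniformly_computable_reals_def
    by (intro exI conjI, rule computable_recursive2[OF a], rule computable.zero, rule computable_recursive2[OF den])
       (use approx in simp)
  then show ?thesis unfolding Schnorr_test_def using Martin_Loef_test_G[OF assms] by simp
qed

end

section \<open>A modulus from a computable measure, and the three kinds of randomness\<close>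

context open_target
begin

text \<open>The stages have computable rational measures increasing to that of
  \<open>target\<close>. Once the limit can be approximated, a stage close to it is found by
  search.\<close>

lemma modulus_of_computable_measure:
  assumes "computable_real (1 - cantor.prob target)"
  obtains h where "recursive (\<lambda>e. h (e 0))"
    "\<And>d. cantor.prob target - cantor.prob (stage (h d)) \<le> (1 / 2) ^ d"
proof -
  obtain a b c where abc: "computable 1 a" "computable 1 b" "computable 1 c"
    and approx: "\<And>n. \<bar>(1 - cantor.prob target) - (real (a [n]) - real (b [n])) / real (Suc (c [n]))\<bar> \<le> (1 / 2) ^ n"
    using assms unfolding computable_real_def by blast
  have unary: "recursive (\<lambda>e. f [e 0])" if "computable 1 f" for f
    using recursive_computable[OF that, of "\<lambda>_ e. e 0"] recursive_var by simp
  note abc' = recursive_unary[where f="\<lambda>x. a [x]", OF unary[OF abc(1)]]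
    recursive_unary[where f="\<lambda>x. b [x]", OF unary[OF abc(2)]]
    recursive_unary[where f="\<lambda>x. c [x]", OF unary[OF abc(3)]]
  define X where "X t = (\<Sum>x<2 ^ t. of_bool (W t x) :: nat)" for t
  \<comment> \<open>This is the inequality of \<open>C_iff\<close> multiplied by all denominators,
    with subtracted terms moved across so that only natural numbers occur.\<close>
  define C where "C d t \<longleftrightarrow> 2 ^ t * Suc (c [d + 2]) * 2 ^ (d + 1) + b [d + 2] * 2 ^ t * 2 ^ (d + 1)
    \<le> X t * Suc (c [d + 2]) * 2 ^ (d + 1) + a [d + 2] * 2 ^ t * 2 ^ (d + 1) + 2 ^ t * Suc (c [d + 2])" for d t
  have prob_X: "cantor.prob (stage t) = real (X t) / 2 ^ t" for t
    unfolding stage_def X_def by (rule prob_prefix_class_sum)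
  define q where "q d = (real (a [d + 2]) - real (b [d + 2])) / real (Suc (c [d + 2]))" for d
  have C_iff: "C d t \<longleftrightarrow> 1 - q d - (1 / 2) ^ (d + 1) \<le> cantor.prob (stage t)" for d t
  proof -
    have "C d t \<longleftrightarrow> real (2 ^ t * Suc (c [d + 2]) * 2 ^ (d + 1) + b [d + 2] * 2 ^ t * 2 ^ (d + 1))
      \<le> real (X t * Suc (c [d + 2]) * 2 ^ (d + 1) + a [d + 2] * 2 ^ t * 2 ^ (d + 1) + 2 ^ t * Suc (c [d + 2]))"
      unfolding C_def of_nat_le_iff ..
    also have "\<dots> \<longleftrightarrow> 1 - q d - (1 / 2) ^ (d + 1) \<le> real (X t) / 2 ^ t"
    proof -
      define s where "s = real (Suc (c [d + 2]))"
      have s: "s > 0" by (simp add: s_def)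
      show ?thesis unfolding q_def of_nat_add of_nat_mult of_nat_power of_nat_numeral s_def[symmetric]
          power_one_over
        using s by (simp add: field_simps del: power_Suc)
    qed
    finally show ?thesis by (simp only: prob_X)
  qed
  \<comment> \<open>Put \<open>\<epsilon> = (1 / 2) ^ (d + 2)\<close>. The threshold lies
    \<open>2 * \<epsilon>\<close> below the approximate limit \<open>1 - q d\<close>, so a stage
    within \<open>\<epsilon>\<close> of the target passes, and a stage that passes is within
    \<open>3 * \<epsilon>\<close>.\<close>
  have q: "\<bar>1 - cantor.prob target - q d\<bar> \<le> (1 / 2) ^ (d + 2)" for d
    using approx[of "d + 2"] by (simp only: q_def)
  have half: "(1 / 2) ^ (d + 1) = 2 * (1 / 2 :: real) ^ (d + 2)" "(1 / 2) ^ d = 4 * (1 / 2 :: real) ^ (d + 2)" for d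
    by (simp_all add: power_add)
  have ex: "\<exists>t. C d t" for d
  proof -
    obtain t where "cantor.prob target - cantor.prob (stage t) < (1 / 2) ^ (d + 2)"
      using stage_limit[of "(1 / 2) ^ (d + 2)"] by auto
    then have "C d t" unfolding C_iff using q[of d] half[of d] by linarith
    then show ?thesis ..
  qed
  define h where "h d = (LEAST t. C d t)" for d
  show thesis
  proof (rule that[of h])
    show "recursive (\<lambda>e. h (e 0))" unfolding h_def
    proof (rule recursive_Least[where P="\<lambda>t e. C (e 0) t", OF _ ex])
      show "decidable (\<lambda>e. C (e (Suc 0)) (e 0))" unfolding C_def X_def
        by (intro recursive_intros abc' decidable_binary[where P=W, OF decidable_W])
    qed
    show "cantor.prob target - cantor.prob (stage (h d)) \<le> (1 / 2) ^ d" for d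
      using LeastI_ex[OF ex, of d, folded h_def] q[of d] half[of d] unfolding C_iff by linarith
  qed
qed

lemma not_always_bad:
  assumes "cantor.prob target < 1"
    and random: "Kurtz_random Y \<and> (\<exists>T. target = stage T) \<or>
      Schnorr_random Y \<and> computable_real (1 - cantor.prob target) \<or> Martin_Loef_random Y"
  shows "\<exists>n\<ge>1. Y \<notin> bad n"
proof (rule ccontr)
  assume "\<not> ?thesis"
  then have Y: "\<And>n. 1 \<le> n \<Longrightarrow> Y \<in> bad n" by blast
  obtain c n0 where c: "0 \<le> c" "c < 1" "\<And>n. n0 \<le> n \<Longrightarrow> cantor.prob (bad n) \<le> c"
    using prob_bad_bound[OF assms(1)] by blast
  \<comment> \<open>Recurrence concerns powers \<open>n \<ge> 1\<close>, so the tested powers must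
    be positive.\<close>
  interpret sparse_returns k \<phi> N W "max 1 n0" c
    by unfold_locales (use c in auto)
  obtain L where "c ^ L < 1 / 2"
    using real_arch_pow_inv[of "1 / 2" c] c by auto
  then have L: "c ^ L \<le> 1 / 2" by simp
  from random show False
  proof (elim disjE conjE exE)
    fix T assume "Kurtz_random Y" "target = stage T"
    then show False
      using Pi01_class_always_bad prob_always_bad Y unfolding Kurtz_random_def by blast
  next
    assume "Martin_Loef_random Y"
    then show False
      using Martin_Loef_test_G[OF L] always_bad_in_G[OF Y] unfolding Martin_Loef_random_def by blast
  next
    assume S: "Schnorr_random Y" and "computable_real (1 - cantor.prob target)"
    then obtain h where h: "recursive (\<lambda>e. h (e 0))"
      "\<And>d. cantor.prob target - cantor.prob (stage (h d)) \<le> (1 / 2) ^ d"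
      using modulus_of_computable_measure by blast
    interpret computable_sparse_returns k \<phi> N W "max 1 n0" c h
      by unfold_locales (use h in auto)
    show False
      using S Schnorr_test_G[OF L] always_bad_in_G[OF Y] unfolding Schnorr_random_def by blast
  qed
qed

end

section \<open>Transfer to arrays\<close>

locale array_coding =
  fixes k :: nat and \<pi> :: "nat list \<Rightarrow> nat"
  assumes k_pos: "k \<ge> 1" and bij: "computable_bijection k \<pi>"
begin

definition cell :: "nat \<Rightarrow> nat list" where
  "cell j = inv_into (index k) \<pi> j"

definition cantor_shift :: "nat \<Rightarrow> nat \<Rightarrow> nat \<Rightarrow> nat" where
  "cantor_shift i n j = \<pi> ((cell j)[i := cell j ! i + n])"

text \<open>It exceeds every coordinate of the first \<open>t\<close> cells, so adding at least
  \<open>spread t\<close> in one direction moves any cell out of the first \<open>t\<close>.\<close>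

definition spread :: "nat \<Rightarrow> nat" where
  "spread t = Suc (\<Sum>j<t. \<Sum>i<k. cell j ! i)"

lemma bij_betw_pi: "bij_betw \<pi> (index k) UNIV"
  using bij by (simp add: computable_bijection_def)

lemma pi_cell [simp]: "\<pi> (cell j) = j"
  unfolding cell_def using bij_betw_pi by (metis UNIV_I bij_betw_inv_into_right)

lemma length_cell [simp]: "length (cell j) = k"
  unfolding cell_def using bij_betw_pi inv_into_into[of j \<pi> "index k"]
  by (simp add: index_def bij_betw_def)

lemma cell_pi: "length u = k \<Longrightarrow> cell (\<pi> u) = u"
  unfolding cell_def using bij_betw_pi by (simp add: bij_betw_def index_def)

text \<open>Entries of an iterated pairing: one number stands for a tuple, and a search over tuples
  becomes a minimization.\<close>

definition decode :: "nat \<Rightarrow> nat \<Rightarrow> nat" where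
  "decode i z = fst (prod_decode (((\<lambda>z. snd (prod_decode z)) ^^ i) z))"

lemma decode_surj: "\<exists>z. \<forall>i<length u. decode i z = u ! i"
proof (induction u)
  case (Cons a u)
  then obtain z where z: "\<forall>i<length u. decode i z = u ! i" by blast
  have "decode 0 (prod_encode (a, z)) = a" by (simp add: decode_def)
  moreover have "decode (Suc i) (prod_encode (a, z)) = decode i z" for i
    by (simp add: decode_def funpow_Suc_right del: funpow.simps(2))
  ultimately show ?case using z
    by (intro exI[of _ "prod_encode (a, z)"]) (auto simp: less_Suc_eq_0_disj)
qed simp

lemma recursive_decode: "recursive a \<Longrightarrow> recursive (\<lambda>e. decode i (a e))"
proof -
  assume a: "recursive a"
  have "recursive (\<lambda>e. ((\<lambda>z. snd (prod_decode z)) ^^ i) (a e))"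
  proof (induction i)
    case (Suc i)
    from recursive_snd_prod_decode[OF this] show ?case by simp
  qed (simp add: a)
  then show ?thesis unfolding decode_def by (rule recursive_fst_prod_decode)
qed

lemma recursive_pi: "(\<And>i. i < k \<Longrightarrow> recursive (g i)) \<Longrightarrow> recursive (\<lambda>e. \<pi> (map (\<lambda>i. g i e) [0..<k]))"
  using recursive_computable bij by (simp add: computable_bijection_def)

text \<open>The inverse of a computable bijection is computed by searching all tuples: surjectivity
  makes the search total, injectivity makes its result the right cell.\<close>

lemma recursive_cell:
  assumes "recursive a" "i < k"
  shows "recursive (\<lambda>e. cell (a e) ! i)"
proof (rule recursive_unary[where f="\<lambda>j. cell j ! i", OF _ assms(1)])
  define z where "z j = (LEAST z. \<pi> (map (\<lambda>i. decode i z) [0..<k]) = j)" for j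
  have ex: "\<exists>z. \<pi> (map (\<lambda>i. decode i z) [0..<k]) = j" for j
  proof -
    obtain z where "\<forall>i<k. decode i z = cell j ! i" using decode_surj[of "cell j"] by auto
    then have "map (\<lambda>i. decode i z) [0..<k] = cell j" by (intro nth_equalityI) auto
    then show ?thesis by (metis pi_cell)
  qed
  have "cell j = map (\<lambda>i. decode i (z j)) [0..<k]" for j
    using LeastI_ex[OF ex, of j, folded z_def] cell_pi[of "map (\<lambda>i. decode i (z j)) [0..<k]"] by simp
  then have eq: "cell j ! i = decode i (z j)" for j using assms(2) by simp
  have "recursive (\<lambda>e. z (e 0))" unfolding z_def
  proof (rule recursive_Least[where P="\<lambda>z e. \<pi> (map (\<lambda>i. decode i z) [0..<k]) = e 0", OF _ ex])
    show "decidable (\<lambda>e. \<pi> (map (\<lambda>i. decode i (e 0)) [0..<k]) = e (Suc 0))"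
      by (intro recursive_intros recursive_pi recursive_decode)
  qed
  then show "recursive (\<lambda>e. cell (e 0) ! i)" unfolding eq by (rule recursive_decode)
qed

lemma cell_less_spread: "j < t \<Longrightarrow> i < k \<Longrightarrow> cell j ! i < spread t"
proof -
  assume ij: "j < t" "i < k"
  have "cell j ! i \<le> (\<Sum>i<k. cell j ! i)"
    using ij by (intro member_le_sum[of i "{..<k}" "\<lambda>i. cell j ! i"]) auto
  also have "\<dots> \<le> (\<Sum>j<t. \<Sum>i<k. cell j ! i)"
    using ij by (intro member_le_sum[of j "{..<t}" "\<lambda>j. \<Sum>i<k. cell j ! i"]) auto
  finally show ?thesis by (simp add: spread_def)
qed

lemma cell_cantor_shift: "cell (cantor_shift i n j) = (cell j)[i := cell j ! i + n]"
  unfolding cantor_shift_def by (rule cell_pi) simp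

sublocale shift_system k cantor_shift spread
proof
  show "recursive (\<lambda>e. cantor_shift i (e 0) (e 1))" if "i < k" for i
  proof -
    have "recursive (\<lambda>e. \<pi> (map (\<lambda>i'. cell (e 1) ! i' + (if i' = i then e 0 else 0)) [0..<k]))"
      by (intro recursive_pi recursive_add recursive_cell recursive_if decidable_const recursive_var recursive_const)
    moreover have "map (\<lambda>i'. cell j ! i' + (if i' = i then n else 0)) [0..<k] = (cell j)[i := cell j ! i + n]" for n j
      by (rule nth_equalityI) (auto simp: nth_list_update)
    ultimately show ?thesis by (simp add: cantor_shift_def)
  qed
  show "recursive (\<lambda>e. spread (e 0))" unfolding spread_def
    by (intro recursive_intros recursive_cell)
  show "inj (cantor_shift i n)" if "i < k" for i n
  proof (rule injI)
    fix j j' assume "cantor_shift i n j = cantor_shift i n j'"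
    from arg_cong[OF this, of cell]
    have eq: "(cell j)[i := cell j ! i + n] = (cell j')[i := cell j' ! i + n]"
      by (simp only: cell_cantor_shift)
    have "cell j = cell j'"
    proof (rule nth_equalityI)
      show "cell j ! l = cell j' ! l" if "l < length (cell j)" for l
        using arg_cong[OF eq, of "\<lambda>u. u ! l"] that by (cases "l = i") auto
    qed simp
    then show "j = j'" by (metis pi_cell)
  qed
  show "t \<le> cantor_shift i n j" if "i < k" "spread t \<le> n" for i n t j
  proof (rule ccontr)
    assume "\<not> t \<le> cantor_shift i n j"
    then have "cell (cantor_shift i n j) ! i < spread t" using that(1) by (intro cell_less_spread) auto
    then show False using that by (simp add: cell_cantor_shift)
  qed
  show "i = i'" if *: "i < k" "i' < k" "spread t \<le> n" "j < t" "j' < t" "cantor_shift i n j = cantor_shift i' n j'"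
    for i i' n t j j'
  proof (rule ccontr)
    assume "i \<noteq> i'"
    have eq: "(cell j)[i := cell j ! i + n] = (cell j')[i' := cell j' ! i' + n]"
      using arg_cong[OF *(6), of cell] by (simp only: cell_cantor_shift)
    \<comment> \<open>Only the left side is shifted in direction \<open>i\<close>, so entry
      \<open>i\<close> of \<open>cell j'\<close>, one of the first \<open>t\<close> cells, would
      have to be at least \<open>n\<close>.\<close>
    have "(cell j)[i := cell j ! i + n] ! i = (cell j')[i' := cell j' ! i' + n] ! i"
      by (simp only: eq)
    then have "cell j ! i + n = cell j' ! i"
      using \<open>i \<noteq> i'\<close> *(1) by simp
    then show False using cell_less_spread[OF *(5,1)] *(3) by simp
  qed
qed (rule k_pos)

section \<open>Shifts, measure and topology under the coding\<close>

lemma to_cantor_apply: "to_cantor k \<pi> Z j = Z (cell j)"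
  by (simp add: to_cantor_def cell_def)

lemma inj_on_to_cantor: "inj_on (to_cantor k \<pi>) (array_space k)"
proof (rule inj_onI)
  fix Z Z' assume Z: "Z \<in> array_space k" "Z' \<in> array_space k" "to_cantor k \<pi> Z = to_cantor k \<pi> Z'"
  show "Z = Z'"
  proof (rule PiE_ext[of Z "index k" _ Z'])
    show "Z u = Z' u" if "u \<in> index k" for u
      using fun_cong[OF Z(3), of "\<pi> u"] that by (simp add: to_cantor_apply cell_pi index_def)
  qed (use Z in \<open>auto simp: array_space_def\<close>)
qed

lemma funpow_shift:
  assumes "Z \<in> array_space k" "i < k"
  shows "(shift k i ^^ n) Z = (\<lambda>u\<in>index k. Z (u[i := u ! i + n]))"
proof (induction n)
  case 0
  have "Z \<in> extensional (index k)" using assms(1) by (simp add: array_space_def PiE_def)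
  then show ?case by (auto simp: extensional_def fun_eq_iff)
next
  case (Suc n)
  show ?case unfolding funpow.simps comp_def Suc
    using assms(2) by (auto simp: shift_def index_def restrict_def fun_eq_iff)
qed

lemma to_cantor_funpow_shift:
  assumes "Z \<in> array_space k" "i < k"
  shows "to_cantor k \<pi> ((shift k i ^^ n) Z) = (\<lambda>j. to_cantor k \<pi> Z (cantor_shift i n j))"
  unfolding funpow_shift[OF assms]
  by (simp add: to_cantor_apply cell_cantor_shift index_def fun_eq_iff)

lemma multiply_recurrent_iff:
  assumes "Z \<in> array_space k" "P \<subseteq> array_space k"
  shows "multiply_recurrent k P Z \<longleftrightarrow>
    (\<exists>n\<ge>1. \<forall>i<k. (\<lambda>j. to_cantor k \<pi> Z (cantor_shift i n j)) \<in> to_cantor k \<pi> ` P)"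
proof -
  have "(shift k i ^^ n) Z \<in> P \<longleftrightarrow> (\<lambda>j. to_cantor k \<pi> Z (cantor_shift i n j)) \<in> to_cantor k \<pi> ` P"
    if "i < k" for i n
  proof -
    have "(shift k i ^^ n) Z \<in> array_space k"
      unfolding funpow_shift[OF assms(1) that] array_space_def by simp
    then show ?thesis
      using inj_on_image_mem_iff[OF inj_on_to_cantor _ assms(2)] to_cantor_funpow_shift[OF assms(1) that]
      by metis
  qed
  then show ?thesis unfolding multiply_recurrent_def by auto
qed

text \<open>\<open>to_cantor\<close> renames coordinates along a bijection and so carries one
  product measure to the other; injectivity makes \<open>P\<close> the full preimage of its
  image.\<close>

lemma measure_to_cantor_image:
  assumes "P \<subseteq> array_space k" "to_cantor k \<pi> ` P \<in> sets cantor_measure"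
  shows "measure (array_measure k) P = cantor.prob (to_cantor k \<pi> ` P)"
proof -
  let ?M = "\<lambda>_. measure_pmf (pmf_of_set (UNIV :: bool set))"
  have eq: "to_cantor k \<pi> = (\<lambda>Z. \<lambda>j\<in>UNIV. Z (cell j))"
    by (simp add: to_cantor_apply fun_eq_iff)
  have meas: "to_cantor k \<pi> \<in> measurable (array_measure k) cantor_measure"
    unfolding eq array_measure_def cantor_measure_def
    by (rule measurable_restrict) (rule measurable_component_singleton, simp add: index_def)
  have "distr (array_measure k) cantor_measure (to_cantor k \<pi>) = cantor_measure"
    unfolding eq array_measure_def cantor_measure_def
    by (rule distr_PiM_reindex)
       (auto simp: index_def inj_def intro: measure_pmf.prob_space_axioms, metis pi_cell)
  then have "cantor.prob (to_cantor k \<pi> ` P)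
      = measure (array_measure k) (to_cantor k \<pi> -` (to_cantor k \<pi> ` P) \<inter> space (array_measure k))"
    using measure_distr[OF meas assms(2)] by simp
  also have "space (array_measure k) = array_space k"
    by (simp add: array_measure_def array_space_def space_PiM)
  also have "to_cantor k \<pi> -` (to_cantor k \<pi> ` P) \<inter> array_space k = P"
    using inj_on_image_mem_iff[OF inj_on_to_cantor _ assms(1)] assms(1) by blast
  finally show ?thesis ..
qed

lemma openin_prefix_class:
  "openin (array_topology k) {Z \<in> array_space k. D (prefix_code (to_cantor k \<pi> Z) t)}"
  unfolding array_topology_def openin_product_topology_alt
proof
  fix Z assume Z: "Z \<in> {Z \<in> array_space k. D (prefix_code (to_cantor k \<pi> Z) t)}"
  define U where "U u = (if u \<in> cell ` {..<t} then {Z u} else UNIV)" for u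
  have "finite {u \<in> index k. U u \<noteq> topspace (discrete_topology UNIV)}"
    by (rule finite_subset[of _ "cell ` {..<t}"]) (auto simp: U_def)
  moreover have "Z \<in> Pi\<^sub>E (index k) U" using Z by (auto simp: U_def array_space_def PiE_def)
  moreover have "Pi\<^sub>E (index k) U \<subseteq> {Z \<in> array_space k. D (prefix_code (to_cantor k \<pi> Z) t)}"
  proof
    fix Z' assume Z': "Z' \<in> Pi\<^sub>E (index k) U"
    have "Z' (cell j) = Z (cell j)" if "j < t" for j
      using PiE_mem[OF Z', of "cell j"] that by (simp add: index_def U_def)
    then have "prefix_code (to_cantor k \<pi> Z') t = prefix_code (to_cantor k \<pi> Z) t"
      by (intro prefix_code_cong) (simp add: to_cantor_apply)
    with Z Z' show "Z' \<in> {Z \<in> array_space k. D (prefix_code (to_cantor k \<pi> Z) t)}"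
      by (auto simp: array_space_def PiE_def)
  qed
  ultimately show "\<exists>U. finite {i \<in> index k. U i \<noteq> topspace (discrete_topology UNIV)} \<and>
      (\<forall>i\<in>index k. openin (discrete_topology UNIV) (U i)) \<and> Z \<in> Pi\<^sub>E (index k) U \<and>
      Pi\<^sub>E (index k) U \<subseteq> {Z \<in> array_space k. D (prefix_code (to_cantor k \<pi> Z) t)}"
    by (intro exI[of _ U]) auto
qed

lemma surj_to_cantor: "to_cantor k \<pi> ` array_space k = UNIV"
proof -
  have "Y \<in> to_cantor k \<pi> ` array_space k" for Y
    by (rule image_eqI[of _ _ "\<lambda>u\<in>index k. Y (\<pi> u)"])
       (auto simp: to_cantor_apply index_def array_space_def fun_eq_iff)
  then show ?thesis by blast
qed

text \<open>The complement of a clopen \<open>P\<close> is closed in a compact space. The stages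
  cover it by increasing open sets, so a single stage already exhausts it.\<close>

lemma clopen_finite_stage:
  assumes P: "clopen_in_array k P" and "P \<subseteq> array_space k"
    and W: "\<And>Y s t. s \<le> t \<Longrightarrow> W s (prefix_code Y s) \<Longrightarrow> W t (prefix_code Y t)"
    and target: "- to_cantor k \<pi> ` P = {Y. \<exists>t. W t (prefix_code Y t)}"
  shows "\<exists>T. - to_cantor k \<pi> ` P = {Y. W T (prefix_code Y T)}"
proof -
  define A where "A t = {Z \<in> array_space k. W t (prefix_code (to_cantor k \<pi> Z) t)}" for t
  have top: "topspace (array_topology k) = array_space k"
    by (simp add: array_topology_def array_space_def)
  have "compact_space (array_topology k)"
    unfolding array_topology_def by (simp add: compact_space_product_topology compact_space_discrete_topology)
  moreover have "closedin (array_topology k) (array_space k - P)"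
    using P by (metis clopen_in_array_def openin_closedin_eq top)
  ultimately have "compactin (array_topology k) (array_space k - P)"
    by (rule closedin_compact_space)
  moreover have "openin (array_topology k) (A t)" for t
    unfolding A_def by (rule openin_prefix_class)
  moreover have cover: "array_space k - P = (\<Union>t. A t)"
  proof -
    have "Z \<notin> P \<longleftrightarrow> (\<exists>t. W t (prefix_code (to_cantor k \<pi> Z) t))" if "Z \<in> array_space k" for Z
      using inj_on_image_mem_iff[OF inj_on_to_cantor that assms(2)] target by blast
    then show ?thesis by (auto simp: A_def)
  qed
  ultimately obtain \<F> where F: "finite \<F>" "\<F> \<subseteq> range A" "array_space k - P \<subseteq> \<Union>\<F>"
    unfolding compactin_def by (metis (no_types, lifting) imageE order_refl)
  then obtain I where I: "finite I" "\<F> = A ` I" by (meson finite_subset_image)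
  obtain T where T: "\<And>t. t \<in> I \<Longrightarrow> t \<le> T" using I(1) by (meson finite_nat_set_iff_bounded_le)
  have "A t \<subseteq> A T" if "t \<in> I" for t using W[OF T[OF that]] by (auto simp: A_def)
  then have "array_space k - P = A T" using F(3) cover I(2) by blast
  then have "Z \<notin> P \<longleftrightarrow> W T (prefix_code (to_cantor k \<pi> Z) T)" if "Z \<in> array_space k" for Z
    using that by (auto simp: A_def)
  then have "to_cantor k \<pi> Z \<in> - to_cantor k \<pi> ` P \<longleftrightarrow> W T (prefix_code (to_cantor k \<pi> Z) T)"
    if "Z \<in> array_space k" for Z
    using inj_on_image_mem_iff[OF inj_on_to_cantor that assms(2)] that by blast
  then have "Y \<in> - to_cantor k \<pi> ` P \<longleftrightarrow> W T (prefix_code Y T)" for Y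
    using surj_to_cantor by (metis UNIV_I imageE)
  then show ?thesis by blast
qed

end

theorem theorem6p1:
  fixes k :: nat and \<pi> :: "nat list \<Rightarrow> nat"
    and P :: "(nat list \<Rightarrow> bool) set" and Z :: "nat list \<Rightarrow> bool"
  assumes "k \<ge> 1"
    and "computable_bijection k \<pi>"
    and "Pi01_array_class k \<pi> P"
    and "measure (array_measure k) P > 0"
    and "Z \<in> array_space k"
  shows "(Kurtz_random (to_cantor k \<pi> Z) \<and> clopen_in_array k P \<longrightarrow> multiply_recurrent k P Z) \<and>
    (Schnorr_random (to_cantor k \<pi> Z) \<and> computable_real (measure (array_measure k) P)
      \<longrightarrow> multiply_recurrent k P Z) \<and>
    (Martin_Loef_random (to_cantor k \<pi> Z) \<longrightarrow> multiply_recurrent k P Z)"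
proof -
  interpret array_coding k \<pi> by unfold_locales (use assms in auto)
  let ?C = "to_cantor k \<pi> ` P" and ?Y = "to_cantor k \<pi> Z"
  have P: "P \<subseteq> array_space k" and "Sigma01_class (- ?C)"
    using assms(3) by (auto simp: Pi01_array_class_def Pi01_class_def)
  then obtain W where W: "decidable (\<lambda>e. W (e 0) (e 1))"
    "\<And>Y s t. s \<le> t \<Longrightarrow> W s (prefix_code Y s) \<Longrightarrow> W t (prefix_code Y t)"
    "- ?C = {Y. \<exists>t. W t (prefix_code Y t)}"
    by (elim Sigma01_class_decidableE) blast
  interpret open_target k cantor_shift spread W
    by unfold_locales (use W in auto)
  have target: "target = - ?C" by (simp add: target_def W(3))
  then have "?C = space cantor_measure - target" by auto
  moreover from this have "?C \<in> sets cantor_measure" using sets.compl_sets[OF sets_target] by simp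
  ultimately have measure_P: "measure (array_measure k) P = 1 - cantor.prob target"
    using measure_to_cantor_image[OF P] cantor.prob_compl[OF sets_target] by simp
  have rec: "multiply_recurrent k P Z \<longleftrightarrow> (\<exists>n\<ge>1. ?Y \<notin> bad n)"
    unfolding multiply_recurrent_iff[OF assms(5) P] bad_def target by auto
  have "\<exists>T. target = stage T" if "clopen_in_array k P"
    using clopen_finite_stage[OF that P W(2,3)] unfolding target stage_def .
  then show ?thesis
    unfolding rec using not_always_bad[of ?Y] assms(4) unfolding measure_P by auto
qed

end
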